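(* Let $\lambda^{(m)}$ be an $m$-partition of $n$ and let $U_{\lambda^{(m)}}$ be the $K$-vector space with basis $\{\mathcal{X}_{\lambda^{(m)}}\}$ indexed by the standard $m$-tableaux $X_{\lambda^{(m)}}$ of shape $\lambda^{(m)}$. Then the formulas $$\sigma_i:\ \mathcal{X}_{\lambda^{(m)}}\mapsto \frac{(q-q^{-1})\,c(X_{\lambda^{(m)}}|i+1)}{c(X_{\lambda^{(m)}}|i+1)-c(X_{\lambda^{(m)}}|i)}\,\mathcal{X}_{\lambda^{(m)}}+\frac{q\,c(X_{\lambda^{(m)}}|i+1)-q^{-1}c(X_{\lambda^{(m)}}|i)}{c(X_{\lambda^{(m)}}|i+1)-c(X_{\lambda^{(m)}}|i)}\,\mathcal{X}^{s_i}_{\lambda^{(m)}}\qquad(i=1,\dots,n-1)$$ and $$\tau:\ \mathcal{X}_{\lambda^{(m)}}\mapsto c(X_{\lambda^{(m)}}|1)\,\mathcal{X}_{\lambda^{(m)}}$$ define a representation of the algebra $H(m,1,n)$ on $U_{\lambda^{(m)}}$.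
   Context: Parameters. Let $m,n\ge 1$. Either $K=\mathbb{C}(q,v_1,\dots,v_m)$ with $q,v_1,\dots,v_m$ indeterminates, or $K=\mathbb{C}$ and $q,v_1,\dots,v_m\in\mathbb{C}$, $q\neq0$, satisfy: $1+q^2+\dots+q^{2N}\neq0$ for all non-negative integers $N<n$; $q^{2i}v_j-v_k\neq0$ for all $i,j,k$ with $j\neq k$ and $-n<i<n$; $v_j\neq0$ for all $j=1,\dots,m$. Cyclotomic Hecke algebra. $H(m,1,n)$ is the associative unital $K$-algebra generated by $\tau,\sigma_1,\dots,\sigma_{n-1}$ with defining relations $\sigma_i\sigma_{i+1}\sigma_i=\sigma_{i+1}\sigma_i\sigma_{i+1}$; $\sigma_i\sigma_j=\sigma_j\sigma_i$ if $|i-j|>1$; $\tau\sigma_1\tau\sigma_1=\sigma_1\tau\sigma_1\tau$; $\tau\sigma_i=\sigma_i\tau$ for $i>1$; $\sigma_i^2=(q-q^{-1})\sigma_i+1$; $(\tau-v_1)\cdots(\tau-v_m)=0$. Tableaux. An $m$-partition of $n$ is an $m$-tuple $\lambda^{(m)}=(\lambda_1,\dots,\lambda_m)$ of partitions (Young diagrams) with $|\lambda_1|+\dots+|\lambda_m|=n$. Its $m$-nodes are the nodes of the diagrams together with the index $k$ of the diagram. The content of the $m$-node in row $r$ and column $s$ of the $k$-th diagram is $v_kq^{2(s-r)}$. A standard $m$-tableau of shape $\lambda^{(m)}$ is a bijective filling of the $m$-nodes with $1,\dots,n$ such that in every diagram the numbers increase along rows (to the right) and columns (downwards). $c(X_{\lambda^{(m)}}|i)$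 is the content of the $m$-node carrying $i$ in $X_{\lambda^{(m)}}$. $X_{\lambda^{(m)}}^{s_i}$ is obtained from $X_{\lambda^{(m)}}$ by exchanging the numbers $i$ and $i+1$; $\mathcal{X}_{\lambda^{(m)}}^{s_i}$ is the corresponding basis vector if $X_{\lambda^{(m)}}^{s_i}$ is standard, and $0$ otherwise.
   Formalization: For K = ℂ the stated conditions allow q² = 1, where the σ_i formula can be 0/0 (e.g. m=1, n=2, q=1); the formal statement then additionally assumes c(X|i+1) ≠ c(X|i) for all standard X and all i; for q² ≠ 1 this is proved. *)

theory Defs
  imports
    Complex_Main
    "HOL-Library.Poly_Mapping"
    "HOL-Library.Option_ord"
    "HOL-Library.FuncSet"
    "HOL-Computational_Algebra.Fraction_Field"
    "HOL-Combinatorics.Transposition"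
    "HOL-Algebra.QuotRing"
    "HOL-Algebra.Module"
begin

text \<open>
  The \<open>m\<close> parameters \<open>v\<^sub>1, \<dots>, v\<^sub>m\<close> and the \<open>m\<close> diagrams are indexed by an arbitrary finite
  linearly ordered type \<open>'m\<close>, so that \<open>m = CARD('m) \<ge> 1\<close>.
\<close>

section \<open>The ground field and the parameters\<close>

text \<open>
  The field \<open>\<complex>(q, v\<^sub>1, \<dots>, v\<^sub>m)\<close>: fractions of polynomials over \<open>\<complex>\<close> in variables indexed by
  \<open>'m option\<close>, where \<open>None\<close> stands for \<open>q\<close> and \<open>Some j\<close> for \<open>v\<^sub>j\<close>.
\<close>

type_synonym 'm ratfun = "(('m option \<Rightarrow>\<^sub>0 nat) \<Rightarrow>\<^sub>0 complex) fract"

definition indet :: "'m option \<Rightarrow> 'm::linorder ratfun" where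
  "indet x = Fract (Poly_Mapping.single (Poly_Mapping.single x 1) 1) 1"

definition q_indet :: "'m::linorder ratfun" where
  "q_indet = indet None"

definition v_indet :: "'m \<Rightarrow> 'm::linorder ratfun" where
  "v_indet j = indet (Some j)"

definition admissible :: "nat \<Rightarrow> complex \<Rightarrow> ('m \<Rightarrow> complex) \<Rightarrow> bool" where
  "admissible n q v \<longleftrightarrow>
     q \<noteq> 0 \<and>
     (\<forall>N<n. (\<Sum>k\<le>N. q ^ (2 * k)) \<noteq> 0) \<and>
     (\<forall>i j k. j \<noteq> k \<and> - int n < i \<and> i < int n \<longrightarrow> q powi (2 * i) * v j - v k \<noteq> 0) \<and>
     (\<forall>j. v j \<noteq> 0)"

section \<open>Free vector spaces, free algebras, endomorphism algebras\<close>

definition scale :: "'k::field \<Rightarrow> ('b \<Rightarrow>\<^sub>0 'k) \<Rightarrow> ('b \<Rightarrow>\<^sub>0 'k)" where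
  "scale c x = Poly_Mapping.map ((*) c) x"

definition free_space :: "'b set \<Rightarrow> ('b \<Rightarrow>\<^sub>0 'k::field) set" where
  "free_space B = {x. Poly_Mapping.keys x \<subseteq> B}"

text \<open>
  The free monoid is written additively only because convolution on \<open>\<Rightarrow>\<^sub>0\<close> is defined
  for exponents of class \<^class>\<open>monoid_add\<close>.
\<close>

datatype 'g fword = Word (letters: "'g list")

instantiation fword :: (type) monoid_add
begin

definition zero_fword :: "'a fword" where
  "0 = Word []"

definition plus_fword :: "'a fword \<Rightarrow> 'a fword \<Rightarrow> 'a fword" where
  "u + w = Word (letters u @ letters w)"

instance
  by standard (auto simp: zero_fword_def plus_fword_def)

end

definition gen :: "'g \<Rightarrow> ('g fword \<Rightarrow>\<^sub>0 'k::field)" where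
  "gen g = Poly_Mapping.single (Word [g]) 1"

definition scalar :: "'k \<Rightarrow> ('g fword \<Rightarrow>\<^sub>0 'k::field)" where
  "scalar c = Poly_Mapping.single 0 c"

definition free_algebra :: "'g set \<Rightarrow> ('g fword \<Rightarrow>\<^sub>0 'k::field) ring" where
  "free_algebra G =
     \<lparr>carrier = free_space {w. set (letters w) \<subseteq> G}, mult = (*), one = 1, zero = 0, add = (+)\<rparr>"

lemma ring_free_algebra: "ring (free_algebra G :: ('g fword \<Rightarrow>\<^sub>0 'k::field) ring)"
proof (rule ringI)
  let ?F = "free_algebra G :: ('g fword \<Rightarrow>\<^sub>0 'k) ring"
  have keys_plus: "Poly_Mapping.keys (x + y) \<subseteq> Poly_Mapping.keys x \<union> Poly_Mapping.keys y"
    for x y :: "'g fword \<Rightarrow>\<^sub>0 'k"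
    by (rule Poly_Mapping.keys_add)
  show "abelian_group ?F"
  proof (rule abelian_groupI)
    fix x assume "x \<in> carrier ?F"
    then show "\<exists>y\<in>carrier ?F. y \<oplus>\<^bsub>?F\<^esub> x = \<zero>\<^bsub>?F\<^esub>"
      by (intro bexI[of _ "- x"]) (auto simp: free_algebra_def free_space_def keys_def)
  qed (use keys_plus in \<open>fastforce simp: free_algebra_def free_space_def algebra_simps\<close>)+
  have closed: "x * y \<in> carrier ?F" if "x \<in> carrier ?F" "y \<in> carrier ?F" for x y
    using that keys_mult[of x y]
    by (fastforce simp: free_algebra_def free_space_def plus_fword_def)
  show "monoid ?F"
    by (rule monoidI)
      (use closed in \<open>auto simp: free_algebra_def free_space_def zero_fword_def algebra_simps\<close>)
qed (auto simp: free_algebra_def algebra_simps)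

text \<open>
  As in the library, a \<open>module\<close> record carries the ring operations together with a scalar
  multiplication; here it is used for (noncommutative) algebras over \<open>'k\<close>.
\<close>

definition algebra_hom :: "('k, 'a) module \<Rightarrow> ('k, 'b) module \<Rightarrow> ('a \<Rightarrow> 'b) set" where
  "algebra_hom A B =
     {h \<in> ring_hom A B. \<forall>c. \<forall>a\<in>carrier A. h (c \<odot>\<^bsub>A\<^esub> a) = c \<odot>\<^bsub>B\<^esub> h a}"

definition end_algebra :: "('b \<Rightarrow>\<^sub>0 'k::field) set \<Rightarrow>
    ('k, ('b \<Rightarrow>\<^sub>0 'k) \<Rightarrow> ('b \<Rightarrow>\<^sub>0 'k)) module" where
  "end_algebra V =
     \<lparr>carrier = {f \<in> V \<rightarrow>\<^sub>E V. (\<forall>x\<in>V. \<forall>y\<in>V. f (x + y) = f x + f y) \<and>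
                             (\<forall>c. \<forall>x\<in>V. f (scale c x) = scale c (f x))},
      mult = compose V,
      one = (\<lambda>x\<in>V. x),
      zero = (\<lambda>x\<in>V. 0),
      add = (\<lambda>f g. \<lambda>x\<in>V. f x + g x),
      smult = (\<lambda>c f. \<lambda>x\<in>V. scale c (f x))\<rparr>"

section \<open>The cyclotomic Hecke algebra \<open>H(m,1,n)\<close>\<close>

datatype hecke_gen = Tau | Sigma nat

definition hecke_gens :: "nat \<Rightarrow> hecke_gen set" where
  "hecke_gens n = insert Tau (Sigma ` {1..<n})"

abbreviation t_gen :: "hecke_gen fword \<Rightarrow>\<^sub>0 'k::field" where
  "t_gen \<equiv> gen Tau"

abbreviation s_gen :: "nat \<Rightarrow> (hecke_gen fword \<Rightarrow>\<^sub>0 'k::field)" where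
  "s_gen i \<equiv> gen (Sigma i)"

text \<open>A relation \<open>a = b\<close> is represented by the element \<open>a - b\<close>.\<close>

definition hecke_rels ::
    "nat \<Rightarrow> 'k::field \<Rightarrow> ('m::{finite,linorder} \<Rightarrow> 'k) \<Rightarrow> (hecke_gen fword \<Rightarrow>\<^sub>0 'k) set" where
  "hecke_rels n q v =
     {s_gen i * s_gen (i+1) * s_gen i - s_gen (i+1) * s_gen i * s_gen (i+1) | i.
        1 \<le> i \<and> i + 1 < n}
   \<union> {s_gen i * s_gen j - s_gen j * s_gen i | i j.
        i \<in> {1..<n} \<and> j \<in> {1..<n} \<and> \<bar>int i - int j\<bar> > 1}
   \<union> (if 1 < n then {t_gen * s_gen 1 * t_gen * s_gen 1 - s_gen 1 * t_gen * s_gen 1 * t_gen} else {})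
   \<union> {t_gen * s_gen i - s_gen i * t_gen | i. 1 < i \<and> i < n}
   \<union> {s_gen i * s_gen i - (scalar (q - inverse q) * s_gen i + 1) | i. i \<in> {1..<n}}
   \<union> {prod_list (map (\<lambda>j. t_gen - scalar (v j)) (sorted_list_of_set UNIV))}"

definition hecke_ideal ::
    "nat \<Rightarrow> 'k::field \<Rightarrow> ('m::{finite,linorder} \<Rightarrow> 'k) \<Rightarrow> (hecke_gen fword \<Rightarrow>\<^sub>0 'k) set" where
  "hecke_ideal n q v = Idl\<^bsub>free_algebra (hecke_gens n)\<^esub> (hecke_rels n q v)"

definition hecke_class ::
    "nat \<Rightarrow> 'k::field \<Rightarrow> ('m::{finite,linorder} \<Rightarrow> 'k) \<Rightarrow>
     (hecke_gen fword \<Rightarrow>\<^sub>0 'k) \<Rightarrow> (hecke_gen fword \<Rightarrow>\<^sub>0 'k) set" where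
  "hecke_class n q v a = hecke_ideal n q v +>\<^bsub>free_algebra (hecke_gens n)\<^esub> a"

definition hecke_algebra ::
    "nat \<Rightarrow> 'k::field \<Rightarrow> ('m::{finite,linorder} \<Rightarrow> 'k) \<Rightarrow>
     ('k, (hecke_gen fword \<Rightarrow>\<^sub>0 'k) set) module" where
  "hecke_algebra n q v =
     (let H = free_algebra (hecke_gens n) Quot hecke_ideal n q v in
      \<lparr>carrier = carrier H, mult = mult H, one = one H, zero = zero H, add = add H,
       smult = (\<lambda>c X. hecke_class n q v (scalar c) \<otimes>\<^bsub>H\<^esub> X)\<rparr>)"

section \<open>Multipartitions and standard tableaux\<close>

definition is_partition :: "nat list \<Rightarrow> bool" where
  "is_partition p \<longleftrightarrow> sorted_wrt (\<ge>) p \<and> (\<forall>x\<in>set p. 0 < x)"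

definition is_mpartition :: "nat \<Rightarrow> ('m::finite \<Rightarrow> nat list) \<Rightarrow> bool" where
  "is_mpartition n lam \<longleftrightarrow>
     (\<forall>k. is_partition (lam k)) \<and> (\<Sum>k\<in>UNIV. sum_list (lam k)) = n"

text \<open>\<open>(k, r, s)\<close> is the node in row \<open>r\<close> and column \<open>s\<close> (both counted from 1) of the \<open>k\<close>-th diagram.\<close>

type_synonym 'm node = "'m \<times> nat \<times> nat"

definition nodes :: "('m \<Rightarrow> nat list) \<Rightarrow> 'm node set" where
  "nodes lam = {(k, r, s). 1 \<le> r \<and> r \<le> length (lam k) \<and> 1 \<le> s \<and> s \<le> lam k ! (r - 1)}"

definition node_content :: "'k::field \<Rightarrow> ('m \<Rightarrow> 'k) \<Rightarrow> 'm node \<Rightarrow> 'k" where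
  "node_content q v = (\<lambda>(k, r, s). v k * q powi (2 * (int s - int r)))"

text \<open>Fillings are extensional, so that distinct functions are distinct tableaux.\<close>

definition std_tableaux :: "nat \<Rightarrow> ('m \<Rightarrow> nat list) \<Rightarrow> ('m node \<Rightarrow> nat) set" where
  "std_tableaux n lam =
     {X \<in> extensional (nodes lam).
        bij_betw X (nodes lam) {1..n} \<and>
        (\<forall>k r s s'. (k, r, s) \<in> nodes lam \<and> (k, r, s') \<in> nodes lam \<and> s < s' \<longrightarrow>
           X (k, r, s) < X (k, r, s')) \<and>
        (\<forall>k r r' s. (k, r, s) \<in> nodes lam \<and> (k, r', s) \<in> nodes lam \<and> r < r' \<longrightarrow>
           X (k, r, s) < X (k, r', s))}"

definition tab_content ::
    "'k::field \<Rightarrow> ('m \<Rightarrow> 'k) \<Rightarrow> ('m \<Rightarrow> nat list) \<Rightarrow> ('m node \<Rightarrow> nat) \<Rightarrow> nat \<Rightarrow> 'k" where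
  "tab_content q v lam X i = node_content q v (inv_into (nodes lam) X i)"

definition swap_tab ::
    "('m \<Rightarrow> nat list) \<Rightarrow> nat \<Rightarrow> ('m node \<Rightarrow> nat) \<Rightarrow> ('m node \<Rightarrow> nat)" where
  "swap_tab lam i X = (\<lambda>a\<in>nodes lam. transpose i (i + 1) (X a))"

definition basis_vec ::
    "nat \<Rightarrow> ('m \<Rightarrow> nat list) \<Rightarrow> ('m node \<Rightarrow> nat) \<Rightarrow> (('m node \<Rightarrow> nat) \<Rightarrow>\<^sub>0 'k::field)" where
  "basis_vec n lam X = (if X \<in> std_tableaux n lam then Poly_Mapping.single X 1 else 0)"

section \<open>The action on tableaux\<close>

text \<open>
  For admissible complex parameters the denominators below can vanish only if \<open>q\<^sup>2 = 1\<close>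
  (a value that \<^const>\<open>admissible\<close> does not exclude); the coefficients are then of the form \<open>0/0\<close>.
\<close>

definition denominators_nonzero ::
    "nat \<Rightarrow> 'k::field \<Rightarrow> ('m \<Rightarrow> 'k) \<Rightarrow> ('m \<Rightarrow> nat list) \<Rightarrow> bool" where
  "denominators_nonzero n q v lam \<longleftrightarrow>
     (\<forall>X\<in>std_tableaux n lam. \<forall>i\<in>{1..<n}.
        tab_content q v lam X (i + 1) - tab_content q v lam X i \<noteq> 0)"

definition sigma_formula ::
    "nat \<Rightarrow> 'k::field \<Rightarrow> ('m \<Rightarrow> 'k) \<Rightarrow> ('m \<Rightarrow> nat list) \<Rightarrow> nat \<Rightarrow> ('m node \<Rightarrow> nat) \<Rightarrow>
     (('m node \<Rightarrow> nat) \<Rightarrow>\<^sub>0 'k)" where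
  "sigma_formula n q v lam i X =
     (let c = tab_content q v lam X i; c' = tab_content q v lam X (i + 1) in
        scale ((q - inverse q) * c' / (c' - c)) (basis_vec n lam X)
      + scale ((q * c' - inverse q * c) / (c' - c)) (basis_vec n lam (swap_tab lam i X)))"

definition tau_formula ::
    "nat \<Rightarrow> 'k::field \<Rightarrow> ('m \<Rightarrow> 'k) \<Rightarrow> ('m \<Rightarrow> nat list) \<Rightarrow> ('m node \<Rightarrow> nat) \<Rightarrow>
     (('m node \<Rightarrow> nat) \<Rightarrow>\<^sub>0 'k)" where
  "tau_formula n q v lam X = scale (tab_content q v lam X 1) (basis_vec n lam X)"

text \<open>
  Division by zero being total in HOL, the requirement that the formulas make sense is
  stated explicitly.
\<close>

definition formulas_define_representation ::
    "nat \<Rightarrow> 'k::field \<Rightarrow> ('m::{finite,linorder} \<Rightarrow> 'k) \<Rightarrow> ('m \<Rightarrow> nat list) \<Rightarrow> bool" where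
  "formulas_define_representation n q v lam \<longleftrightarrow>
     denominators_nonzero n q v lam \<and>
     (\<exists>\<rho> \<in> algebra_hom (hecke_algebra n q v) (end_algebra (free_space (std_tableaux n lam))).
        (\<forall>i\<in>{1..<n}. \<forall>X\<in>std_tableaux n lam.
           \<rho> (hecke_class n q v (s_gen i)) (basis_vec n lam X) = sigma_formula n q v lam i X) \<and>
        (\<forall>X\<in>std_tableaux n lam.
           \<rho> (hecke_class n q v t_gen) (basis_vec n lam X) = tau_formula n q v lam X))"

end

(*
  Write a, b for the contents of i, i+1 and D(a,b), O(a,b) for the coefficients of X and of its
  image under the exchange of i and i+1. Each defining relation applied to a basis vector becomes
  rational identities between D and O, one for every filling reachable from X. Nonstandard
  fillings do no harm: if the exchange is not standard, i and i+1 are neighbours in a row or a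
  column, their contents differ by the factor q^2 or q^-2, and O(a,b) O(b,a) = 0, so the formulas
  may be applied as if the zero vector were a basis vector. The braid coefficient identities need
  the contents of i and i+2 to be distinct; when they coincide, i, i+1, i+2 lie consecutively in
  one row or in one column (no corner is possible in a standard tableau) and D takes the same
  value, q or -1/q, on both pairs. The denominators do not vanish because consecutive entries
  never share a diagonal of the same diagram and diagonals of occupied nodes are less than n apart.
*)

theory Submission
  imports Defs
begin

section \<open>Evaluating the free algebra\<close>

lemma lookup_scale [simp]: "Poly_Mapping.lookup (scale c x) k = c * Poly_Mapping.lookup x k"
  by (simp add: scale_def Poly_Mapping.map.rep_eq when_def)

lemma scale_distribs:
  "scale c (x + y) = scale c x + scale c y"
  "scale (c + d) x = scale c x + scale d x"
  "scale c (x - y) = scale c x - scale c y"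
  "scale c (scale d x) = scale (c * d) x"
  by (rule poly_mapping_eqI; simp add: lookup_add lookup_minus algebra_simps)+

lemma scale_simps [simp]: "scale c 0 = 0" "scale 0 x = 0" "scale 1 x = x"
  by (rule poly_mapping_eqI; simp)+

lemma scale_sum: "scale c (sum f A) = (\<Sum>a\<in>A. scale c (f a))"
  by (induction A rule: infinite_finite_induct) (auto simp: scale_distribs)

lemma scale_in_free_space: "x \<in> free_space B \<Longrightarrow> scale c x \<in> free_space B"
  by (auto simp: free_space_def in_keys_iff)

lemma add_in_free_space: "x \<in> free_space B \<Longrightarrow> y \<in> free_space B \<Longrightarrow> x + y \<in> free_space B"
  using Poly_Mapping.keys_add[of x y] by (auto simp: free_space_def)

lemma sum_in_free_space: "(\<And>a. a \<in> A \<Longrightarrow> f a \<in> free_space B) \<Longrightarrow> sum f A \<in> free_space B"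
  by (induction A rule: infinite_finite_induct)
    (simp_all add: add_in_free_space, simp_all add: free_space_def)

text \<open>Updating a value outside the support amounts to adding a monomial. The rule therefore
  reduces an additive statement to monomials, with no bookkeeping of supports.\<close>

lemma poly_mapping_additive_induct [case_names zero single add]:
  fixes a :: "'a \<Rightarrow>\<^sub>0 'k::ab_group_add"
  assumes "P 0" "\<And>k c. P (Poly_Mapping.single k c)" "\<And>a b. P a \<Longrightarrow> P b \<Longrightarrow> P (a + b)"
  shows "P a"
proof (induction a rule: update_induct)
  case (update f k c)
  have "Poly_Mapping.update k c f = f + Poly_Mapping.single k c"
    using update(1)
    by (intro poly_mapping_eqI)
      (auto simp: lookup_update lookup_add lookup_single in_keys_iff when_def)
  then show ?case using update assms by simp
qed (rule assms(1))

section \<open>Extension of an action from the generators to the free algebra\<close>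

definition linear_op :: "(('b \<Rightarrow>\<^sub>0 'k::field) \<Rightarrow> ('b \<Rightarrow>\<^sub>0 'k)) \<Rightarrow> bool" where
  "linear_op f \<longleftrightarrow> (\<forall>x y. f (x + y) = f x + f y) \<and> (\<forall>c x. f (scale c x) = scale c (f x))"

lemma linear_opD:
  assumes "linear_op f"
  shows "f (x + y) = f x + f y" "f (scale c x) = scale c (f x)" "f 0 = 0" "f (x - y) = f x - f y"
proof -
  show add: "f (x + y) = f x + f y" for x y
    using assms by (simp add: linear_op_def)
  show "f (scale c x) = scale c (f x)"
    using assms by (simp add: linear_op_def)
  show "f 0 = 0"
    using add[of 0 0] by simp
  show "f (x - y) = f x - f y"
    using add[of "x - y" y] by simp
qed

lemma linear_op_sum: "linear_op f \<Longrightarrow> f (sum g A) = (\<Sum>a\<in>A. f (g a))"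
  by (induction A rule: infinite_finite_induct) (auto simp: linear_opD)

text \<open>Folding from the right applies the last letter first, so concatenation of words becomes
  composition of operators in the order used by \<open>end_algebra\<close>.\<close>

definition evaluate ::
    "('g \<Rightarrow> ('b \<Rightarrow>\<^sub>0 'k::field) \<Rightarrow> ('b \<Rightarrow>\<^sub>0 'k)) \<Rightarrow> ('g fword \<Rightarrow>\<^sub>0 'k) \<Rightarrow> ('b \<Rightarrow>\<^sub>0 'k) \<Rightarrow> ('b \<Rightarrow>\<^sub>0 'k)" where
  "evaluate T a y = (\<Sum>w\<in>Poly_Mapping.keys a. scale (Poly_Mapping.lookup a w) (foldr T (letters w) y))"

text \<open>Linearity is asked on all finitely supported functions, so that rewriting with it has no
  membership conditions; only invariance mentions \<open>B\<close>.\<close>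

locale linear_action =
  fixes T :: "'g \<Rightarrow> ('b \<Rightarrow>\<^sub>0 'k::field) \<Rightarrow> ('b \<Rightarrow>\<^sub>0 'k)" and B :: "'b set"
  assumes linear: "linear_op (T g)"
    and invariant: "y \<in> free_space B \<Longrightarrow> T g y \<in> free_space B"
begin

lemma linear_word: "linear_op (foldr T gs)"
  by (induction gs) (use linear in \<open>auto simp: linear_op_def\<close>)

lemma linear_evaluate: "linear_op (evaluate T a)"
  using linear_word
  by (auto simp: linear_op_def evaluate_def scale_distribs scale_sum sum.distrib mult.commute)

lemma evaluate_in_free_space: "y \<in> free_space B \<Longrightarrow> evaluate T a y \<in> free_space B"
proof -
  assume y: "y \<in> free_space B"
  have "foldr T gs y \<in> free_space B" for gs
    by (induction gs) (use y invariant in auto)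
  then show ?thesis
    by (auto simp: evaluate_def intro!: sum_in_free_space scale_in_free_space)
qed

lemma evaluate_zero [simp]: "evaluate T 0 y = 0"
  by (simp add: evaluate_def)

lemma evaluate_single [simp]:
  "evaluate T (Poly_Mapping.single w c) y = scale c (foldr T (letters w) y)"
  by (simp add: evaluate_def)

lemma evaluate_gen [simp]: "evaluate T (gen g) y = T g y"
  by (simp add: gen_def)

lemma evaluate_scalar [simp]: "evaluate T (scalar c) y = scale c y"
  by (simp add: scalar_def zero_fword_def)

lemma evaluate_one [simp]: "evaluate T 1 y = y"
  using evaluate_scalar[of 1 y] by (simp add: scalar_def del: evaluate_scalar)

lemma evaluate_add [simp]: "evaluate T (a + b) y = evaluate T a y + evaluate T b y"
  unfolding evaluate_def
  by (rule setsum_keys_plus_distrib) (auto simp: scale_distribs)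

lemma evaluate_diff [simp]: "evaluate T (a - b) y = evaluate T a y - evaluate T b y"
  using evaluate_add[of "a - b" b y] by simp

text \<open>Both sides are additive in \<open>a\<close> and in \<open>b\<close>, which leaves two
  monomials; there the words are concatenated and the scalars pass through the linear word
  operators.\<close>

lemma evaluate_mult [simp]: "evaluate T (a * b) y = evaluate T a (evaluate T b y)"
proof (induction a rule: poly_mapping_additive_induct)
  case (single u c)
  show ?case
    by (induction b rule: poly_mapping_additive_induct)
      (auto simp: mult_single plus_fword_def scale_distribs distrib_left
        linear_opD[OF linear_word])
qed (simp_all add: distrib_right)

end

section \<open>Representations of the cyclotomic Hecke algebra\<close>

lemma carrier_free_algebraI:
  "gen g \<in> carrier (free_algebra G)" if "g \<in> G"
  using that by (auto simp: free_algebra_def free_space_def gen_def)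

lemma scalar_in_carrier: "scalar c \<in> carrier (free_algebra G)"
  by (auto simp: free_algebra_def free_space_def scalar_def zero_fword_def)

lemma free_algebra_simps [simp]:
  "mult (free_algebra G) = (*)" "one (free_algebra G) = 1"
  "zero (free_algebra G) = 0" "add (free_algebra G) = (+)"
  by (simp_all add: free_algebra_def)

lemma free_algebra_closed:
  fixes a b :: "'g fword \<Rightarrow>\<^sub>0 'k::field" and G :: "'g set"
  defines "F \<equiv> free_algebra G :: ('g fword \<Rightarrow>\<^sub>0 'k::field) ring"
  shows "a \<in> carrier F \<Longrightarrow> b \<in> carrier F \<Longrightarrow> a * b \<in> carrier F"
    and "a \<in> carrier F \<Longrightarrow> b \<in> carrier F \<Longrightarrow> a + b \<in> carrier F"
    and "a \<in> carrier F \<Longrightarrow> b \<in> carrier F \<Longrightarrow> a - b \<in> carrier F"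
    and "1 \<in> carrier F" and "0 \<in> carrier F"
proof -
  interpret ring F unfolding F_def by (rule ring_free_algebra)
  show "a \<in> carrier F \<Longrightarrow> b \<in> carrier F \<Longrightarrow> a * b \<in> carrier F"
    "a \<in> carrier F \<Longrightarrow> b \<in> carrier F \<Longrightarrow> a + b \<in> carrier F"
    "1 \<in> carrier F" "0 \<in> carrier F"
    using m_closed[of a b] a_closed[of a b] one_closed zero_closed by (auto simp: F_def)
  show "a \<in> carrier F \<Longrightarrow> b \<in> carrier F \<Longrightarrow> a - b \<in> carrier F"
    using keys_diff[of a b] by (auto simp: F_def free_algebra_def free_space_def)
qed

lemma hecke_rels_carrier:
  "hecke_rels n q v \<subseteq> carrier (free_algebra (hecke_gens n) :: (hecke_gen fword \<Rightarrow>\<^sub>0 'k::field) ring)"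
proof -
  let ?F = "free_algebra (hecke_gens n) :: (hecke_gen fword \<Rightarrow>\<^sub>0 'k) ring"
  have t: "t_gen \<in> carrier ?F"
    by (rule carrier_free_algebraI) (simp add: hecke_gens_def)
  have s: "s_gen i \<in> carrier ?F" if "1 \<le> i" "i < n" for i
    by (rule carrier_free_algebraI) (use that in \<open>simp add: hecke_gens_def\<close>)
  have p: "prod_list (map (\<lambda>j. t_gen - scalar (v j)) L) \<in> carrier ?F" for L
    by (induction L) (auto intro!: free_algebra_closed t scalar_in_carrier)
  show ?thesis
    unfolding hecke_rels_def
    by (auto intro!: free_algebra_closed s t p scalar_in_carrier split: if_splits)
qed

locale hecke_action = linear_action T B
  for T :: "hecke_gen \<Rightarrow> ('b \<Rightarrow>\<^sub>0 'k::field) \<Rightarrow> ('b \<Rightarrow>\<^sub>0 'k)" and B :: "'b set" +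
  fixes n :: nat and q :: 'k and v :: "'m::{finite,linorder} \<Rightarrow> 'k"
  assumes relations: "a \<in> hecke_rels n q v \<Longrightarrow> y \<in> free_space B \<Longrightarrow> evaluate T a y = 0"
begin

abbreviation "F \<equiv> free_algebra (hecke_gens n) :: (hecke_gen fword \<Rightarrow>\<^sub>0 'k) ring"
abbreviation "V \<equiv> free_space B :: ('b \<Rightarrow>\<^sub>0 'k) set"

lemma ideal_hecke_ideal: "ideal (hecke_ideal n q v) F"
  unfolding hecke_ideal_def
  by (rule ring.genideal_ideal[OF ring_free_algebra hecke_rels_carrier])

text \<open>The elements that annihilate \<open>V\<close> form a two-sided ideal containing the
  relations, hence containing the ideal they generate. Closure under multiplication on the right
  uses the invariance of \<open>V\<close>.\<close>

lemma evaluate_hecke_ideal: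
  assumes "a \<in> hecke_ideal n q v" "y \<in> V"
  shows "evaluate T a y = 0"
proof -
  let ?K = "{a \<in> carrier F. \<forall>y\<in>V. evaluate T a y = 0}"
  interpret F: ring F by (rule ring_free_algebra)
  have neg: "\<ominus>\<^bsub>F\<^esub> a = - a" if "a \<in> carrier F" for a
    using F.r_neg[OF that] by (metis add.inverse_unique free_algebra_simps(3,4))
  have "ideal ?K F"
  proof (rule idealI[OF ring_free_algebra])
    show "subgroup ?K (add_monoid F)"
    proof (rule F.add.subgroupI)
      show "\<ominus>\<^bsub>F\<^esub> a \<in> ?K" if "a \<in> ?K" for a
      proof -
        \<comment> \<open>The additive inverse of the ring record is \<open>- a\<close>; written as
          \<open>0 - a\<close> it falls under \<open>evaluate_diff\<close>.\<close>
        have "evaluate T (0 - a) y = 0" if "y \<in> V" for y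
          using \<open>a \<in> ?K\<close> that unfolding evaluate_diff by simp
        then show ?thesis
          using that neg F.a_inv_closed[of a] by auto
      qed
    qed (auto intro: free_algebra_closed F.zero_closed)
  qed (auto intro: free_algebra_closed simp: linear_opD[OF linear_evaluate] evaluate_in_free_space)
  moreover have "hecke_rels n q v \<subseteq> ?K"
    using relations hecke_rels_carrier by blast
  ultimately have "hecke_ideal n q v \<subseteq> ?K"
    unfolding hecke_ideal_def by (rule F.genideal_minimal)
  with assms show ?thesis by blast
qed

text \<open>An arbitrary representative of the class is evaluated; on \<open>V\<close> the choice is
  immaterial. The restriction makes the operator extensional, as \<open>end_algebra\<close>
  demands.\<close>

definition rep :: "(hecke_gen fword \<Rightarrow>\<^sub>0 'k) set \<Rightarrow> ('b \<Rightarrow>\<^sub>0 'k) \<Rightarrow> ('b \<Rightarrow>\<^sub>0 'k)" where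
  "rep C = restrict (evaluate T (SOME a. a \<in> C)) V"

text \<open>Two representatives of a class differ by an element of the ideal, which evaluates to
  zero on \<open>V\<close>.\<close>

lemma rep_hecke_class:
  assumes "a \<in> carrier F"
  shows "rep (hecke_class n q v a) = restrict (evaluate T a) V"
proof -
  interpret ideal "hecke_ideal n q v" F by (rule ideal_hecke_ideal)
  have self: "a \<in> hecke_class n q v a"
    unfolding hecke_class_def using a_rcos_self[OF assms] .
  have "evaluate T b y = evaluate T a y" if "b \<in> hecke_class n q v a" "y \<in> V" for b y
    using that evaluate_hecke_ideal
    by (auto simp: hecke_class_def a_r_coset_def' )
  then show ?thesis
    unfolding rep_def using someI[of "\<lambda>b. b \<in> hecke_class n q v a", OF self] by auto
qed

text \<open>The operations on classes are computed on representatives, so each law of a homomorphism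
  reduces to the corresponding rule for \<open>evaluate\<close>; a scalar acts as the class of the
  constant \<open>scalar c\<close>.\<close>

lemma rep_algebra_hom: "rep \<in> algebra_hom (hecke_algebra n q v) (end_algebra V)"
proof -
  interpret ideal "hecke_ideal n q v" F by (rule ideal_hecke_ideal)
  let ?H = "hecke_algebra n q v" and ?E = "end_algebra V" and ?c = "hecke_class n q v"
  have carrier: "\<exists>a\<in>carrier F. C = ?c a" if "C \<in> carrier ?H" for C
    using that by (auto simp: hecke_algebra_def FactRing_def A_RCOSETS_def' hecke_class_def)
  have mult: "?c a \<otimes>\<^bsub>?H\<^esub> ?c b = ?c (a * b)" if "a \<in> carrier F" "b \<in> carrier F" for a b
    using rcoset_mult_add[OF that] by (simp add: hecke_algebra_def FactRing_def hecke_class_def)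
  have add: "?c a \<oplus>\<^bsub>?H\<^esub> ?c b = ?c (a + b)" if "a \<in> carrier F" "b \<in> carrier F" for a b
    using a_rcos_sum[OF that] by (simp add: hecke_algebra_def FactRing_def hecke_class_def)
  have smult: "c \<odot>\<^bsub>?H\<^esub> ?c a = ?c (scalar c * a)" if "a \<in> carrier F" for a c
  proof -
    have "c \<odot>\<^bsub>?H\<^esub> ?c a = ?c (scalar c) \<otimes>\<^bsub>?H\<^esub> ?c a"
      unfolding hecke_algebra_def Let_def by simp
    then show ?thesis
      using mult[OF scalar_in_carrier that] by simp
  qed
  have one: "\<one>\<^bsub>?H\<^esub> = ?c 1"
    by (simp add: hecke_algebra_def FactRing_def hecke_class_def)
  note clos = free_algebra_closed scalar_in_carrier
  show ?thesis
    unfolding algebra_hom_def ring_hom_def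
  proof (intro CollectI conjI allI ballI impI Pi_I)
    fix C assume "C \<in> carrier ?H"
    then obtain a where a: "a \<in> carrier F" "C = ?c a" using carrier by blast
    show "rep C \<in> carrier ?E"
      using linear_opD[OF linear_evaluate]
      by (auto simp: a rep_hecke_class end_algebra_def evaluate_in_free_space
          add_in_free_space scale_in_free_space)
    show "rep (c \<odot>\<^bsub>?H\<^esub> C) = c \<odot>\<^bsub>?E\<^esub> rep C" for c
      by (auto simp: a smult rep_hecke_class clos end_algebra_def fun_eq_iff)
  next
    fix C D assume "C \<in> carrier ?H \<and> D \<in> carrier ?H"
    then obtain a b where ab: "a \<in> carrier F" "C = ?c a" "b \<in> carrier F" "D = ?c b"
      using carrier by blast
    show "rep (C \<otimes>\<^bsub>?H\<^esub> D) = rep C \<otimes>\<^bsub>?E\<^esub> rep D"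
      by (auto simp: ab mult rep_hecke_class clos end_algebra_def fun_eq_iff compose_def
          evaluate_in_free_space)
    show "rep (C \<oplus>\<^bsub>?H\<^esub> D) = rep C \<oplus>\<^bsub>?E\<^esub> rep D"
      by (auto simp: ab add rep_hecke_class clos end_algebra_def fun_eq_iff)
  next
    show "rep \<one>\<^bsub>?H\<^esub> = \<one>\<^bsub>?E\<^esub>"
      by (auto simp: one rep_hecke_class clos end_algebra_def fun_eq_iff)
  qed
qed

lemma rep_gen: "g \<in> hecke_gens n \<Longrightarrow> y \<in> V \<Longrightarrow> rep (hecke_class n q v (gen g)) y = T g y"
  by (simp add: rep_hecke_class carrier_free_algebraI)

end

section \<open>Standard tableaux\<close>

lemma nodes_down_closed:
  assumes "is_partition (lam k)" "(k, r', s') \<in> nodes lam" "1 \<le> r" "r \<le> r'" "1 \<le> s" "s \<le> s'"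
  shows "(k, r, s) \<in> nodes lam"
proof -
  have "lam k ! (r' - 1) \<le> lam k ! (r - 1)"
  proof (cases "r = r'")
    case False
    then show ?thesis
      using assms by (auto simp: is_partition_def nodes_def sorted_wrt_iff_nth_less)
  qed simp
  then show ?thesis
    using assms by (auto simp: nodes_def)
qed

text \<open>For distinct nodes of a shape these are exactly the pairs on which standardness imposes
  an order.\<close>

definition collinear :: "'m node \<Rightarrow> 'm node \<Rightarrow> bool" where
  "collinear = (\<lambda>(k, r, s) (k', r', s'). k = k' \<and> (r = r' \<or> s = s'))"

locale shape =
  fixes n :: nat and lam :: "'m::{finite,linorder} \<Rightarrow> nat list"
  assumes partition: "is_partition (lam k)"
begin

abbreviation "std \<equiv> std_tableaux n lam"
abbreviation "pos X i \<equiv> inv_into (nodes lam) X i"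
abbreviation "swap \<equiv> swap_tab lam"

lemma down_closed:
  "(k, r', s') \<in> nodes lam \<Longrightarrow> 1 \<le> r \<Longrightarrow> r \<le> r' \<Longrightarrow> 1 \<le> s \<Longrightarrow> s \<le> s' \<Longrightarrow> (k, r, s) \<in> nodes lam"
  using nodes_down_closed[where lam = lam] partition by blast

section \<open>Fillings and the exchange of consecutive entries\<close>

text \<open>Unlike \<open>std\<close>, this set is closed under every admissible exchange, so
  positions and contents can be followed through nonstandard fillings.\<close>

definition fillings :: "('m node \<Rightarrow> nat) set" where
  "fillings = {X \<in> extensional (nodes lam). bij_betw X (nodes lam) {1..n}}"

lemma std_fillings: "X \<in> std \<Longrightarrow> X \<in> fillings"
  by (simp add: std_tableaux_def fillings_def)

lemma pos_in_nodes: "X \<in> fillings \<Longrightarrow> 1 \<le> i \<Longrightarrow> i \<le> n \<Longrightarrow> pos X i \<in> nodes lam"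
  by (metis (mono_tags, lifting) fillings_def mem_Collect_eq bij_betw_imp_surj_on inv_into_into atLeastAtMost_iff)

lemma at_pos: "X \<in> fillings \<Longrightarrow> 1 \<le> i \<Longrightarrow> i \<le> n \<Longrightarrow> X (pos X i) = i"
  by (metis (mono_tags, lifting) fillings_def mem_Collect_eq bij_betw_imp_surj_on f_inv_into_f atLeastAtMost_iff)

lemma pos_eqI: "X \<in> fillings \<Longrightarrow> a \<in> nodes lam \<Longrightarrow> X a = i \<Longrightarrow> pos X i = a"
  by (auto simp: fillings_def bij_betw_def inv_into_f_f)

lemma filling_range: "X \<in> fillings \<Longrightarrow> a \<in> nodes lam \<Longrightarrow> 1 \<le> X a \<and> X a \<le> n"
  by (auto simp: fillings_def bij_betw_def)

lemma fillings_inj: "X \<in> fillings \<Longrightarrow> a \<in> nodes lam \<Longrightarrow> b \<in> nodes lam \<Longrightarrow> X a = X b \<Longrightarrow> a = b"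
  by (auto simp: fillings_def bij_betw_def inj_on_def)

lemma transpose_bounds:
  "1 \<le> i \<Longrightarrow> i < n \<Longrightarrow> 1 \<le> j \<Longrightarrow> j \<le> n \<Longrightarrow> Suc 0 \<le> transpose i (Suc i) j \<and> transpose i (Suc i) j \<le> n"
  by (auto simp: transpose_def)

lemma swap_fillings:
  assumes X: "X \<in> fillings" and i: "1 \<le> i" "i < n"
  shows "swap i X \<in> fillings"
proof -
  have "bij_betw (transpose i (i+1)) {1..n} {1..n}"
    using i by (intro bij_betwI[of _ _ _ "transpose i (i+1)"]) (auto simp: transpose_def)
  then have "bij_betw (transpose i (i+1) \<circ> X) (nodes lam) {1..n}"
    using X bij_betw_trans by (auto simp: fillings_def)
  then have "bij_betw (swap i X) (nodes lam) {1..n}"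
    by (subst bij_betw_cong[of _ _ "transpose i (i+1) \<circ> X"]) (auto simp: swap_tab_def)
  then show ?thesis
    by (simp add: fillings_def swap_tab_def)
qed

text \<open>A transposition is its own inverse, hence the entry \<open>j\<close> now sits where its
  image sat before.\<close>

lemma pos_swap:
  assumes "X \<in> fillings" "1 \<le> i" "i < n" "1 \<le> j" "j \<le> n"
  shows "pos (swap i X) j = pos X (transpose i (Suc i) j)"
  by (rule pos_eqI[OF swap_fillings])
    (use assms transpose_bounds[of i j] in \<open>auto simp: swap_tab_def pos_in_nodes at_pos\<close>)

text \<open>Through this criterion the relations between exchanges become identities between
  transpositions of numbers.\<close>

lemma filling_eqI:
  assumes "X \<in> fillings" "Y \<in> fillings" "\<And>j. 1 \<le> j \<Longrightarrow> j \<le> n \<Longrightarrow> pos X j = pos Y j"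
  shows "X = Y"
proof (rule extensionalityI[of _ "nodes lam"])
  fix a assume a: "a \<in> nodes lam"
  have "pos Y (X a) = a"
    using assms a filling_range[of X a] pos_eqI[of X a "X a"] by metis
  then show "X a = Y a"
    using at_pos[of Y "X a"] assms a filling_range[of X a] by auto
qed (use assms in \<open>auto simp: fillings_def\<close>)

lemma swap_swap: "X \<in> fillings \<Longrightarrow> 1 \<le> i \<Longrightarrow> i < n \<Longrightarrow> swap i (swap i X) = X"
  by (rule filling_eqI) (auto simp: swap_fillings pos_swap transpose_bounds)

lemma swap_commute:
  assumes "X \<in> fillings" "1 \<le> i" "i < n" "1 \<le> j" "j < n" "i + 1 < j \<or> j + 1 < i"
  shows "swap i (swap j X) = swap j (swap i X)"
  by (rule filling_eqI)
    (use assms in \<open>auto simp: swap_fillings pos_swap transpose_bounds transpose_def\<close>)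

lemma swap_braid:
  assumes "X \<in> fillings" "1 \<le> i" "i + 1 < n"
  shows "swap i (swap (i+1) (swap i X)) = swap (i+1) (swap i (swap (i+1) X))"
  by (rule filling_eqI)
    (use assms in \<open>auto simp: swap_fillings pos_swap transpose_bounds transpose_def\<close>)

lemma finite_nodes: "X \<in> fillings \<Longrightarrow> finite (nodes lam)"
  and card_nodes: "X \<in> fillings \<Longrightarrow> card (nodes lam) = n"
  using bij_betw_finite bij_betw_same_card by (fastforce simp: fillings_def)+

lemma finite_std: "finite std"
proof (cases "std = {}")
  case False
  then obtain X where "X \<in> fillings" using std_fillings by blast
  then have "finite (nodes lam \<rightarrow>\<^sub>E {1..n})"
    by (intro finite_PiE finite_nodes) auto
  moreover have "std \<subseteq> (nodes lam \<rightarrow>\<^sub>E {1..n})"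
  proof
    fix Y assume "Y \<in> std"
    then show "Y \<in> (nodes lam \<rightarrow>\<^sub>E {1..n})"
      using filling_range[OF std_fillings, of Y] by (auto simp: fillings_def std_tableaux_def PiE_def)
  qed
  ultimately show ?thesis using finite_subset by blast
qed simp

section \<open>Standard tableaux: neighbouring entries and diagonals\<close>

lemma std_row: "X \<in> std \<Longrightarrow> (k, r, s) \<in> nodes lam \<Longrightarrow> (k, r, s') \<in> nodes lam \<Longrightarrow> s < s' \<Longrightarrow>
    X (k, r, s) < X (k, r, s')"
  and std_col: "X \<in> std \<Longrightarrow> (k, r, s) \<in> nodes lam \<Longrightarrow> (k, r', s) \<in> nodes lam \<Longrightarrow> r < r' \<Longrightarrow>
    X (k, r, s) < X (k, r', s)"
  by (simp_all add: std_tableaux_def)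

lemma std_less:
  assumes "X \<in> std" "(k, r, s) \<in> nodes lam" "(k, r', s') \<in> nodes lam" "r < r'" "s < s'"
    "(k, r, s') \<in> nodes lam"
  shows "X (k, r, s) < X (k, r, s') \<and> X (k, r, s') < X (k, r', s')"
  using assms std_row[of X k r s s'] std_col[of X k r s' r'] by auto

lemma consecutive_pair:
  assumes X: "X \<in> std" and i: "1 \<le> i" "i < n"
  obtains k r s k' r' s' where "pos X i = (k, r, s)" "pos X (i+1) = (k', r', s')"
    "(k, r, s) \<in> nodes lam" "(k', r', s') \<in> nodes lam"
    "X (k, r, s) = i" "X (k', r', s') = i + 1"
proof -
  obtain k r s k' r' s' where p: "pos X i = (k, r, s)" "pos X (i+1) = (k', r', s')"
    by (metis prod_cases3)
  moreover have "(k, r, s) \<in> nodes lam" "(k', r', s') \<in> nodes lam"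
    using pos_in_nodes[OF std_fillings[OF X]] i p by (metis Suc_eq_plus1 Suc_leI le_add2 less_imp_le)+
  moreover have "X (k, r, s) = i" "X (k', r', s') = i + 1"
    using at_pos[OF std_fillings[OF X], of i] at_pos[OF std_fillings[OF X], of "i+1"] i p by auto
  ultimately show thesis using that by blast
qed

text \<open>No number lies strictly between \<open>i\<close> and \<open>i + 1\<close>, so the
  exchange reverses only the comparison of these two nodes. It destroys standardness exactly when
  that comparison is prescribed.\<close>

lemma swap_std_iff:
  assumes X: "X \<in> std" and i: "1 \<le> i" "i < n"
  shows "swap i X \<in> std \<longleftrightarrow> \<not> collinear (pos X i) (pos X (i+1))"
proof
  assume S: "swap i X \<in> std"
  obtain k r s k' r' s' where p: "pos X i = (k, r, s)" "pos X (i+1) = (k', r', s')"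
    and N: "(k, r, s) \<in> nodes lam" "(k', r', s') \<in> nodes lam"
    and v: "X (k, r, s) = i" "X (k', r', s') = i + 1"
    using consecutive_pair[OF X i] by metis
  have w: "swap i X (k, r, s) = i + 1" "swap i X (k', r', s') = i"
    using N v by (auto simp: swap_tab_def)
  show "\<not> collinear (pos X i) (pos X (i+1))"
  proof
    assume "collinear (pos X i) (pos X (i+1))"
    then consider "k = k'" "r = r'" | "k = k'" "s = s'"
      unfolding p collinear_def by auto
    then show False
    proof cases
      case 1
      then show False
        using std_row[OF X, of k r s s'] std_row[OF X, of k r s' s]
          std_row[OF S, of k r s s'] std_row[OF S, of k r s' s] N v w
        by (cases s s' rule: linorder_cases) auto
    next
      case 2
      then show False
        using std_col[OF X, of k r s r'] std_col[OF X, of k r' s r]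
          std_col[OF S, of k r s r'] std_col[OF S, of k r' s r] N v w
        by (cases r r' rule: linorder_cases) auto
    qed
  qed
next
  assume nc: "\<not> collinear (pos X i) (pos X (i+1))"
  have less: "swap i X a < swap i X b"
    if "a \<in> nodes lam" "b \<in> nodes lam" "X a < X b" "collinear a b" for a b
  proof -
    have "\<not> (X a = i \<and> X b = i + 1)"
      using nc that pos_eqI[OF std_fillings[OF X]] by metis
    then show ?thesis
      using that by (auto simp: swap_tab_def transpose_def)
  qed
  show "swap i X \<in> std"
    using swap_fillings[OF std_fillings[OF X] i] std_row[OF X] std_col[OF X]
    by (auto simp: std_tableaux_def fillings_def intro!: less) (auto simp: collinear_def)
qed

text \<open>A node strictly between the two in their row or column belongs to the diagram and would
  have to carry a number strictly between \<open>i\<close> and \<open>i + 1\<close>.\<close>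

lemma collinear_consecutive:
  assumes X: "X \<in> std" and i: "1 \<le> i" "i < n" and col: "collinear (pos X i) (pos X (i+1))"
  obtains (row) k r s where "pos X i = (k, r, s)" "pos X (i+1) = (k, r, s+1)"
    | (column) k r s where "pos X i = (k, r, s)" "pos X (i+1) = (k, r+1, s)"
proof -
  obtain k r s k' r' s' where p: "pos X i = (k, r, s)" "pos X (i+1) = (k', r', s')"
    and N: "(k, r, s) \<in> nodes lam" "(k', r', s') \<in> nodes lam"
    and v: "X (k, r, s) = i" "X (k', r', s') = i + 1"
    using consecutive_pair[OF X i] by metis
  consider "k = k'" "r = r'" | "k = k'" "s = s'"
    using col unfolding p collinear_def by auto
  then show thesis
  proof cases
    case 1
    have "s < s'"
      using std_row[OF X, of k r s' s] 1 N v by (cases s s' rule: linorder_cases) auto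
    moreover have "\<not> s + 1 < s'"
    proof
      assume "s + 1 < s'"
      moreover have "(k, r, s+1) \<in> nodes lam"
        by (rule down_closed[of k r s']) (use 1 N \<open>s < s'\<close> in \<open>auto simp: nodes_def\<close>)
      ultimately show False
        using std_row[OF X, of k r s "s+1"] std_row[OF X, of k r "s+1" s'] 1 N v by auto
    qed
    ultimately have "s' = s + 1" by simp
    then show thesis using row p 1 by auto
  next
    case 2
    have "r < r'"
      using std_col[OF X, of k r' s r] 2 N v by (cases r r' rule: linorder_cases) auto
    moreover have "\<not> r + 1 < r'"
    proof
      assume "r + 1 < r'"
      moreover have "(k, r+1, s) \<in> nodes lam"
        by (rule down_closed[of k r' s]) (use 2 N \<open>r < r'\<close> in \<open>auto simp: nodes_def\<close>)
      ultimately show False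
        using std_col[OF X, of k r s "r+1"] std_col[OF X, of k "r+1" s r'] 2 N v by auto
    qed
    ultimately have "r' = r + 1" by simp
    then show thesis using column p 2 by auto
  qed
qed

text \<open>A corner path through three consecutive entries would leave no room for the fourth node
  of its square.\<close>

lemma no_corner:
  assumes X: "X \<in> std" and i: "1 \<le> i" "i + 1 < n"
  shows "\<not> (pos X i = (k, r, s) \<and> pos X (i+1) = (k, r, s+1) \<and> pos X (i+2) = (k, r+1, s+1))"
    and "\<not> (pos X i = (k, r, s) \<and> pos X (i+1) = (k, r+1, s) \<and> pos X (i+2) = (k, r+1, s+1))"
proof -
  have fill: "X \<in> fillings" using X by (rule std_fillings)
  have "pos X (i+1) \<in> {(k, r, s+1), (k, r+1, s)} \<Longrightarrow>
      (k, r, s+1) \<in> nodes lam \<and> (k, r+1, s) \<in> nodes lam \<and>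
      X (k, r, s+1) = X (k, r+1, s)"
    if p: "pos X i = (k, r, s)" "pos X (i+2) = (k, r+1, s+1)"
  proof -
    have N: "(k, r, s) \<in> nodes lam" "(k, r+1, s+1) \<in> nodes lam"
      using pos_in_nodes[OF fill, of i] pos_in_nodes[OF fill, of "i+2"] i p by auto
    have v: "X (k, r, s) = i" "X (k, r+1, s+1) = i + 2"
      using at_pos[OF fill, of i] at_pos[OF fill, of "i+2"] i p by auto
    have M: "(k, r, s+1) \<in> nodes lam" "(k, r+1, s) \<in> nodes lam"
      by (rule down_closed[of k "r+1" "s+1"]; use N in \<open>auto simp: nodes_def\<close>)+
    \<comment> \<open>Both remaining nodes of the square lie between the entries \<open>i\<close>
      and \<open>i + 2\<close>, so both are forced to carry \<open>i + 1\<close>.\<close>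
    have "X (k, r, s+1) = i + 1" "X (k, r+1, s) = i + 1"
      using std_row[OF X, of k r s "s+1"] std_col[OF X, of k r "s+1" "r+1"]
        std_col[OF X, of k r s "r+1"] std_row[OF X, of k "r+1" s "s+1"] M N v by auto
    with M show ?thesis by simp
  qed
  then show "\<not> (pos X i = (k, r, s) \<and> pos X (i+1) = (k, r, s+1) \<and> pos X (i+2) = (k, r+1, s+1))"
    "\<not> (pos X i = (k, r, s) \<and> pos X (i+1) = (k, r+1, s) \<and> pos X (i+2) = (k, r+1, s+1))"
    using fillings_inj[OF fill, of "(k, r, s+1)" "(k, r+1, s)"] by auto
qed

text \<open>Otherwise the first node of the same row or column would carry a number below 1.\<close>

lemma pos_one:
  assumes X: "X \<in> std" and n: "1 \<le> n"
  obtains k where "pos X 1 = (k, 1, 1)"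
proof -
  obtain k r s where p: "pos X 1 = (k, r, s)" by (metis prod_cases3)
  have fill: "X \<in> fillings" using X by (rule std_fillings)
  have N: "(k, r, s) \<in> nodes lam" and v: "X (k, r, s) = 1"
    using pos_in_nodes[OF fill, of 1] at_pos[OF fill, of 1] n p by auto
  have "s = 1"
  proof (rule ccontr)
    assume "s \<noteq> 1"
    then have "1 < s" using N by (auto simp: nodes_def)
    moreover from this have "(k, r, 1) \<in> nodes lam"
      by (intro down_closed[OF N]) (use N in \<open>auto simp: nodes_def\<close>)
    ultimately show False
      using std_row[OF X, of k r 1 s] filling_range[OF fill, of "(k, r, 1)"] N v by auto
  qed
  moreover have "r = 1"
  proof (rule ccontr)
    assume "r \<noteq> 1"
    then have "1 < r" using N by (auto simp: nodes_def)
    moreover from this have "(k, 1, s) \<in> nodes lam"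
      by (intro down_closed[OF N]) (use N in \<open>auto simp: nodes_def\<close>)
    ultimately show False
      using std_col[OF X, of k 1 s r] filling_range[OF fill, of "(k, 1, s)"] N v by auto
  qed
  ultimately show thesis using that p by blast
qed

text \<open>For two distinct nodes of one diagonal, the upper right corner of the rectangle they
  span carries a number strictly between theirs.\<close>

lemma consecutive_not_on_diagonal:
  assumes X: "X \<in> std" and i: "1 \<le> i" "i < n"
    and p: "pos X i = (k, r, s)" "pos X (i+1) = (k, r', s')"
  shows "int s - int r \<noteq> int s' - int r'"
proof
  assume diag: "int s - int r = int s' - int r'"
  have N: "(k, r, s) \<in> nodes lam" "(k, r', s') \<in> nodes lam"
    and v: "X (k, r, s) = i" "X (k, r', s') = i + 1"
    using consecutive_pair[OF X i] p by (metis prod.inject)+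
  consider "r = r'" "s = s'" | "r < r'" "s < s'" | "r' < r" "s' < s"
    using diag by linarith
  then show False
  proof cases
    case 2
    moreover have "(k, r, s') \<in> nodes lam"
      by (rule down_closed[OF N(2)]) (use N 2 in \<open>auto simp: nodes_def\<close>)
    ultimately show False using std_less[OF X N] v by auto
  next
    case 3
    moreover have "(k, r', s) \<in> nodes lam"
      by (rule down_closed[OF N(1)]) (use N 3 in \<open>auto simp: nodes_def\<close>)
    ultimately show False using std_less[OF X N(2,1)] v by auto
  qed (use v in auto)
qed

text \<open>The first-row segment up to one node and the first-column segment down to another share
  at most the corner.\<close>

lemma hook_le:
  assumes X: "X \<in> fillings" and N: "(k, r, s) \<in> nodes lam" "(k', r', s') \<in> nodes lam"
  shows "s + r' \<le> n + 1"
proof -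
  let ?A = "(\<lambda>j. (k, 1::nat, j)) ` {1..s}" and ?B = "(\<lambda>i. (k', i, 1::nat)) ` {1..r'}"
  have bounds: "1 \<le> r" "1 \<le> s'"
    using N by (auto simp: nodes_def)
  have "?A \<subseteq> nodes lam" "?B \<subseteq> nodes lam"
    using down_closed[OF N(1), of 1] down_closed[OF N(2), of _ 1] bounds by auto
  then have "card (?A \<union> ?B) \<le> n"
    using card_mono[OF finite_nodes[OF X]] card_nodes[OF X] by (metis Un_least)
  moreover have "card ?A = s" "card ?B = r'"
    by (subst card_image; auto simp: inj_on_def)+
  \<comment> \<open>The segments can meet only for \<open>k = k'\<close>, and then only in the
    corner; this accounts for the 1 in the bound.\<close>
  moreover have "card (?A \<inter> ?B) \<le> card {(k, 1::nat, 1::nat)}"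
    by (rule card_mono) auto
  moreover have "card ?A + card ?B = card (?A \<union> ?B) + card (?A \<inter> ?B)"
    by (rule card_Un_Int) auto
  ultimately show ?thesis by simp
qed

text \<open>Rows and columns are counted from 1, so the difference is at most s + r' - 2, and
  symmetrically; the hook bound makes this less than n. Different diagrams are included, as the
  comparison of contents requires.\<close>

lemma diagonal_distance:
  assumes X: "X \<in> fillings" and N: "(k, r, s) \<in> nodes lam" "(k', r', s') \<in> nodes lam"
  shows "\<bar>(int s - int r) - (int s' - int r')\<bar> < int n"
  using hook_le[OF X N] hook_le[OF X N(2,1)] N by (auto simp: nodes_def abs_if)

end

section \<open>Standardness along chains of exchanges\<close>

context shape begin

text \<open>Which of two collinear nodes carries the smaller number is decided by the shape
  alone.\<close>

lemma collinear_order: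
  assumes X: "X \<in> std" and Z: "Z \<in> std" and N: "a \<in> nodes lam" "b \<in> nodes lam"
    and col: "collinear a b" and less: "X a < X b"
  shows "Z a < Z b"
proof -
  obtain k r s r' s' where p: "a = (k, r, s)" "b = (k, r', s')"
    using col by (cases a; cases b) (auto simp: collinear_def)
  consider "r = r'" | "s = s'"
    using col unfolding p collinear_def by auto
  then show ?thesis
  proof cases
    case 1
    then show ?thesis
      using std_row[OF X, of k r s' s] std_row[OF Z, of k r s s'] N less unfolding p
      by (cases s s' rule: linorder_cases) auto
  next
    case 2
    then show ?thesis
      using std_col[OF X, of k r' s r] std_col[OF Z, of k r s r'] N less unfolding p
      by (cases r r' rule: linorder_cases) auto
  qed
qed

text \<open>Two standard tableaux agree on collinear nodes, so an inversion relative to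
  \<open>X\<close> proves that the nodes are not collinear. Thus, along exchanges that each create
  an inversion relative to \<open>X\<close>, the predecessor of a standard filling is
  standard.\<close>

lemma swap_std_of_inverted:
  assumes X: "X \<in> std" and Z: "Z \<in> std" and i: "1 \<le> i" "i < n"
    and inv: "X (pos Z (i+1)) < X (pos Z i)"
  shows "swap i Z \<in> std"
proof -
  have fill: "Z \<in> fillings" using Z by (rule std_fillings)
  have N: "pos Z i \<in> nodes lam" "pos Z (i+1) \<in> nodes lam"
    using pos_in_nodes[OF fill] i by auto
  have "collinear (pos Z (i+1)) (pos Z i)" if "collinear (pos Z i) (pos Z (i+1))"
    using that by (auto simp: collinear_def split: prod.splits)
  then show ?thesis
    using collinear_order[OF X Z N(2,1) _ inv] swap_std_iff[OF Z i]
      at_pos[OF fill, of i] at_pos[OF fill, of "i+1"] i by auto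
qed

end

section \<open>The seminormal action\<close>

text \<open>The field stays arbitrary, so that indeterminate and complex parameters are both
  instances.\<close>

locale seminormal = shape n lam for n :: nat and lam :: "'m::{finite,linorder} \<Rightarrow> nat list" +
  fixes q :: "'k::field" and v :: "'m \<Rightarrow> 'k"
  assumes q_nonzero: "q \<noteq> 0" and n_pos: "1 \<le> n"
    and denominators: "denominators_nonzero n q v lam"
begin

abbreviation "cont X i \<equiv> tab_content q v lam X i"
abbreviation e :: "('m node \<Rightarrow> nat) \<Rightarrow> ('m node \<Rightarrow> nat) \<Rightarrow>\<^sub>0 'k" where
  "e X \<equiv> basis_vec n lam X"

text \<open>The first argument is the content of \<open>i\<close>, the second that of
  \<open>i + 1\<close>; exchanging the two entries exchanges the arguments, here and in
  \<open>offdiag\<close>.\<close>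

definition diag :: "'k \<Rightarrow> 'k \<Rightarrow> 'k" where
  "diag a b = (q - inverse q) * b / (b - a)"

definition offdiag :: "'k \<Rightarrow> 'k \<Rightarrow> 'k" where
  "offdiag a b = (q * b - inverse q * a) / (b - a)"

text \<open>Coordinates outside \<open>std\<close> are discarded, which makes the operator total and
  linear everywhere.\<close>

definition act :: "hecke_gen \<Rightarrow> (('m node \<Rightarrow> nat) \<Rightarrow>\<^sub>0 'k) \<Rightarrow> (('m node \<Rightarrow> nat) \<Rightarrow>\<^sub>0 'k)" where
  "act g y = (\<Sum>X\<in>std. scale (Poly_Mapping.lookup y X)
     (case g of Tau \<Rightarrow> tau_formula n q v lam X | Sigma i \<Rightarrow> sigma_formula n q v lam i X))"

lemma basis_in_free_space: "e X \<in> free_space std"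
  by (auto simp: basis_vec_def free_space_def)

sublocale linear_action act std
proof
  show "linear_op (act g)" for g
    by (simp add: linear_op_def act_def lookup_add scale_distribs sum.distrib scale_sum)
  show "act g y \<in> free_space std" for g y
    unfolding act_def
    by (intro sum_in_free_space scale_in_free_space)
      (auto simp: tau_formula_def sigma_formula_def Let_def split: hecke_gen.split
        intro!: add_in_free_space scale_in_free_space basis_in_free_space)
qed

lemma act_basis:
  assumes "X \<in> std"
  shows "act g (e X) =
    (case g of Tau \<Rightarrow> tau_formula n q v lam X | Sigma i \<Rightarrow> sigma_formula n q v lam i X)"
proof -
  have "act g (e X) = (\<Sum>Y\<in>{X}. scale (Poly_Mapping.lookup (e X) Y)
     (case g of Tau \<Rightarrow> tau_formula n q v lam Y | Sigma i \<Rightarrow> sigma_formula n q v lam i Y))"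
    unfolding act_def using assms finite_std
    by (intro sum.mono_neutral_right) (auto simp: basis_vec_def lookup_single when_def)
  then show ?thesis
    using assms by (simp add: basis_vec_def)
qed

lemma basis_nonstd: "X \<notin> std \<Longrightarrow> e X = 0"
  by (simp add: basis_vec_def)

lemma act_zero [simp]: "act g 0 = 0"
  using linear by (rule linear_opD)

lemma tau_basis: "act Tau (e X) = scale (cont X 1) (e X)"
  by (cases "X \<in> std") (simp_all add: act_basis tau_formula_def basis_nonstd)

text \<open>For nonstandard \<open>X\<close> the left side is zero; the hypothesis makes the second
  term on the right vanish as well.\<close>

lemma sigma_basis:
  assumes "swap i X \<in> std \<Longrightarrow> X \<in> std"
  shows "act (Sigma i) (e X) = scale (diag (cont X i) (cont X (i+1))) (e X)
    + scale (offdiag (cont X i) (cont X (i+1))) (e (swap i X))"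
proof (cases "X \<in> std")
  case False
  then have "swap i X \<notin> std" using assms by blast
  with False show ?thesis by (simp add: basis_nonstd)
qed (simp add: act_basis sigma_formula_def Let_def diag_def offdiag_def)

section \<open>Contents and degenerate coefficients\<close>

lemma cont_distinct: "X \<in> std \<Longrightarrow> 1 \<le> i \<Longrightarrow> i < n \<Longrightarrow> cont X i \<noteq> cont X (i+1)"
  using denominators by (force simp: denominators_nonzero_def)

lemma cont_swap:
  "X \<in> fillings \<Longrightarrow> 1 \<le> i \<Longrightarrow> i < n \<Longrightarrow> 1 \<le> j \<Longrightarrow> j \<le> n \<Longrightarrow>
    cont (swap i X) j = cont X (transpose i (Suc i) j)"
  by (simp add: tab_content_def pos_swap)

lemma node_content_step:
  "node_content q v (k, r, s + 1) = q\<^sup>2 * node_content q v (k, r, s)"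
  "node_content q v (k, r + 1, s) = inverse (q\<^sup>2) * node_content q v (k, r, s)"
proof -
  have "q powi (2 * (int (s + 1) - int r)) = q\<^sup>2 * q powi (2 * (int s - int r))"
    using power_int_add[of q 2 "2 * (int s - int r)"] q_nonzero by (simp add: algebra_simps)
  then show "node_content q v (k, r, s + 1) = q\<^sup>2 * node_content q v (k, r, s)"
    by (simp add: node_content_def)
  have "q powi (2 * (int s - int (r + 1))) = inverse (q\<^sup>2) * q powi (2 * (int s - int r))"
    using power_int_add[of q "-2" "2 * (int s - int r)"] q_nonzero
    by (simp add: algebra_simps power_int_minus)
  then show "node_content q v (k, r + 1, s) = inverse (q\<^sup>2) * node_content q v (k, r, s)"
    by (simp add: node_content_def)
qed

lemma diag_row: "a \<noteq> q\<^sup>2 * a \<Longrightarrow> diag a (q\<^sup>2 * a) = q"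
proof -
  assume ne: "a \<noteq> q\<^sup>2 * a"
  then have "q\<^sup>2 * a - a \<noteq> 0" by simp
  then show ?thesis
    using q_nonzero by (simp add: diag_def divide_eq_eq) (simp add: field_simps power2_eq_square)
qed

lemma diag_column: "a \<noteq> inverse (q\<^sup>2) * a \<Longrightarrow> diag a (inverse (q\<^sup>2) * a) = - inverse q"
proof -
  assume ne: "a \<noteq> inverse (q\<^sup>2) * a"
  then have "inverse (q\<^sup>2) * a - a \<noteq> 0" by simp
  then show ?thesis
    using q_nonzero by (simp add: diag_def divide_eq_eq) (simp add: field_simps power2_eq_square)
qed

text \<open>The two entries are neighbours in a row or in a column. In a row the numerator of the
  second factor vanishes, in a column that of the first.\<close>

lemma offdiag_product_zero:
  assumes X: "X \<in> std" and i: "1 \<le> i" "i < n" and non: "swap i X \<notin> std"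
  shows "offdiag (cont X i) (cont X (i+1)) * offdiag (cont X (i+1)) (cont X i) = 0"
proof -
  have "collinear (pos X i) (pos X (i+1))"
    using swap_std_iff[OF X i] non by simp
  then consider "cont X (i+1) = q\<^sup>2 * cont X i" | "cont X (i+1) = inverse (q\<^sup>2) * cont X i"
    by (cases rule: collinear_consecutive[OF X i])
      (auto simp: tab_content_def node_content_step simp del: add_Suc_right One_nat_def)
  then show ?thesis
    by cases (auto simp: offdiag_def power2_eq_square q_nonzero)
qed

text \<open>Both pairs are neighbours and a corner is impossible, so all three entries lie in one
  line, where \<open>diag\<close> is constantly \<open>q\<close> or \<open>- inverse q\<close>. This
  serves the case in which the contents of \<open>i\<close> and \<open>i + 2\<close>
  coincide.\<close>

lemma diag_chain:
  assumes X: "X \<in> std" and i: "1 \<le> i" "i + 1 < n"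
    and non: "swap i X \<notin> std" "swap (i+1) X \<notin> std"
  shows "diag (cont X i) (cont X (i+1)) = diag (cont X (i+1)) (cont X (i+2))"
proof -
  have i2: "i < n" "1 \<le> i + 1" using i by auto
  have ne: "cont X i \<noteq> cont X (i+1)" "cont X (i+1) \<noteq> cont X (i+2)"
    using cont_distinct[OF X, of i] cont_distinct[OF X, of "i+1"] i by auto
  have col: "collinear (pos X i) (pos X (i+1))" "collinear (pos X (i+1)) (pos X (i+1+1))"
    using swap_std_iff[OF X i(1) i2(1)] swap_std_iff[OF X i2(2) i(2)] non by auto
  have "(cont X (i+1) = q\<^sup>2 * cont X i \<and> cont X (i+2) = q\<^sup>2 * cont X (i+1)) \<or>
      (cont X (i+1) = inverse (q\<^sup>2) * cont X i \<and> cont X (i+2) = inverse (q\<^sup>2) * cont X (i+1))"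
  proof (cases rule: collinear_consecutive[OF X i(1) i2(1) col(1)])
    case r: (1 k r s)
    show ?thesis
    proof (cases rule: collinear_consecutive[OF X i2(2) i(2) col(2)])
      case (1 k' r' s')
      then show ?thesis
        using r node_content_step(1)[of k r s] node_content_step(1)[of k' r' s']
        by (simp add: tab_content_def)
    next
      case (2 k' r' s')
      then show ?thesis
        using r no_corner(1)[OF X i, of k r s] by auto
    qed
  next
    case r: (2 k r s)
    show ?thesis
    proof (cases rule: collinear_consecutive[OF X i2(2) i(2) col(2)])
      case (2 k' r' s')
      then show ?thesis
        using r node_content_step(2)[of k r s] node_content_step(2)[of k' r' s']
        by (simp add: tab_content_def)
    next
      case (1 k' r' s')
      then show ?thesis
        using r no_corner(2)[OF X i, of k r s] by auto
    qed
  qed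
  then show ?thesis
    using ne diag_row[of "cont X i"] diag_row[of "cont X (i+1)"]
      diag_column[of "cont X i"] diag_column[of "cont X (i+1)"] by metis
qed

text \<open>When \<open>swap i X\<close> is not standard, the product of the two off-diagonal coefficients vanishes,
  so that the formula for \<open>\<sigma>\<^sub>i\<close> may be applied to the zero vector \<open>e (swap i X)\<close> too.\<close>

lemma sigma_swap_scaled:
  assumes X: "X \<in> std" and i: "1 \<le> i" "i < n"
  defines "a \<equiv> cont X i" and "b \<equiv> cont X (i+1)"
  shows "scale (offdiag a b) (act (Sigma i) (e (swap i X))) =
    scale (offdiag a b * diag b a) (e (swap i X)) + scale (offdiag a b * offdiag b a) (e X)"
proof (cases "swap i X \<in> std")
  case True
  have fill: "X \<in> fillings" using X by (rule std_fillings)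
  have "cont (swap i X) i = b" "cont (swap i X) (i+1) = a"
    using cont_swap[OF fill i, of i] cont_swap[OF fill i, of "i+1"] i by (auto simp: a_def b_def)
  then show ?thesis
    using sigma_basis[of i "swap i X"] True swap_swap[OF fill i] by (simp add: scale_distribs)
next
  case False
  then show ?thesis
    using offdiag_product_zero[OF X i False] by (simp add: basis_nonstd[OF False] a_def b_def del: mult_eq_0_iff)
qed

section \<open>Rational identities between the coefficients\<close>

text \<open>They concern the 2 by 2 block of \<sigma>_i on a tableau and its exchange: a diagonal
  entry of the quadratic relation, the trace, and the cancellation behind the relation with
  \<tau>.\<close>

lemma quadratic_coeffs:
  assumes "a \<noteq> b"
  shows "diag a b * diag a b + offdiag a b * offdiag b a = (q - inverse q) * diag a b + 1"
    and "diag a b + diag b a = q - inverse q"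
    and "a * diag a b + b * diag b a = 0"
proof -
  \<comment> \<open>With x = a/(b - a) one has b/(b - a) = x + 1, and all coefficients become
    polynomials in x, q and p.\<close>
  define x where "x = a * inverse (b - a)"
  define p where "p = inverse q"
  have x: "b * inverse (b - a) = x + 1"
    using assms by (simp add: x_def field_simps)
  have inv: "inverse (a - b) = - inverse (b - a)"
    by (simp flip: inverse_minus_eq)
  have p: "p * q = 1" using q_nonzero by (simp add: p_def)
  have D: "diag a b = (q - p) * (b * inverse (b - a))" "diag b a = - ((q - p) * x)"
    "offdiag a b = q * (b * inverse (b - a)) - p * x" "offdiag b a = p * (b * inverse (b - a)) - q * x"
    by (simp_all only: diag_def offdiag_def divide_inverse inv p_def[symmetric] x_def)
      (simp_all add: algebra_simps)
  note D = D[unfolded x]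
  show "diag a b * diag a b + offdiag a b * offdiag b a = (q - inverse q) * diag a b + 1"
  proof -
    \<comment> \<open>This form is a polynomial identity with p and q independent; only afterwards
      is \<open>p * q\<close> replaced by 1.\<close>
    have "diag a b * diag a b + offdiag a b * offdiag b a = (q - p) * diag a b + p * q"
      unfolding D by (simp add: algebra_simps)
    then show ?thesis using p by (simp add: p_def)
  qed
  show "diag a b + diag b a = q - inverse q"
    unfolding D p_def[symmetric] by (simp add: algebra_simps)
  have "a * (x + 1) = b * x"
    unfolding x[symmetric] by (simp add: x_def mult.left_commute)
  moreover have "a * diag a b + b * diag b a = (q - p) * (a * (x + 1) - b * x)"
    unfolding D by (simp add: algebra_simps)
  ultimately show "a * diag a b + b * diag b a = 0"
    by simp
qed

text \<open>These compare the two sides of the braid relation at the starting tableau and at its two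
  exchanges. The last two are partial fraction identities; the first follows from the second and the
  quadratic identities.\<close>

lemma braid_coeffs:
  assumes "a \<noteq> b" "b \<noteq> c" "a \<noteq> c"
  shows "diag a b * diag a b * diag b c + offdiag a b * offdiag b a * diag a c =
      diag b c * diag b c * diag a b + offdiag b c * offdiag c b * diag a c"
    and "diag a b * diag b c + diag a c * diag b a = diag b c * diag a c"
    and "diag a b * diag a c = diag b c * diag a b + diag a c * diag c b"
proof -
  define d1 where "d1 = inverse (b - a)"
  define d2 where "d2 = inverse (c - b)"
  define d3 where "d3 = inverse (c - a)"
  define p where "p = inverse q"
  have d: "d1 * (b - a) = 1" "d2 * (c - b) = 1" "d3 * (c - a) = 1"
    using assms by (auto simp: d1_def d2_def d3_def)
  have p: "p * q = 1" using q_nonzero by (simp add: p_def)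
  have d': "inverse (a - b) = - d1" "inverse (b - c) = - d2"
    by (simp_all add: d1_def d2_def flip: inverse_minus_eq)
  have D: "diag a b = (q - p) * b * d1" "diag b a = - ((q - p) * a * d1)"
    "diag b c = (q - p) * c * d2" "diag c b = - ((q - p) * b * d2)"
    "diag a c = (q - p) * c * d3"
    by (simp_all add: diag_def divide_inverse d' p_def d1_def[symmetric] d2_def[symmetric] d3_def[symmetric])
  \<comment> \<open>All products of two inverses are brought to the common factor
    \<open>d1 * d2 * d3\<close>, which leaves linear combinations of differences of a, b, c.\<close>
  have d12: "d1 * d2 = d1 * d2 * d3 * (c - a)" and d13: "d1 * d3 = d1 * d2 * d3 * (c - b)"
    and d23: "d2 * d3 = d1 * d2 * d3 * (b - a)"
  proof -
    have "d1 * d2 * d3 * (c - a) = d1 * d2 * (d3 * (c - a))" "d1 * d2 * d3 * (c - b) = d1 * d3 * (d2 * (c - b))"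
      "d1 * d2 * d3 * (b - a) = d2 * d3 * (d1 * (b - a))"
      by (simp_all only: mult_ac)
    then show "d1 * d2 = d1 * d2 * d3 * (c - a)" "d1 * d3 = d1 * d2 * d3 * (c - b)"
      "d2 * d3 = d1 * d2 * d3 * (b - a)"
      by (simp_all add: d)
  qed
  have O: "offdiag a b * offdiag b a = (q - p) * diag a b + 1 - diag a b * diag a b"
    "offdiag b c * offdiag c b = (q - p) * diag b c + 1 - diag b c * diag b c"
    using quadratic_coeffs(1)[OF assms(1)] quadratic_coeffs(1)[OF assms(2)]
    by (simp_all add: p_def algebra_simps)
  have "b * (d1 * d2) - a * (d1 * d3) - c * (d2 * d3) = 0" "d1 * d3 - d1 * d2 + d2 * d3 = 0"
    by (subst d12, subst d13, subst d23, simp add: algebra_simps)+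
  then have "(q - p) * (q - p) * c * (b * (d1 * d2) - a * (d1 * d3) - c * (d2 * d3)) = 0"
    "(q - p) * (q - p) * b * c * (d1 * d3 - d1 * d2 + d2 * d3) = 0"
    by simp_all
  then show id2: "diag a b * diag b c + diag a c * diag b a = diag b c * diag a c"
    and "diag a b * diag a c = diag b c * diag a b + diag a c * diag c b"
    unfolding D by (simp_all only: algebra_simps) (simp_all add: algebra_simps)
  show "diag a b * diag a b * diag b c + offdiag a b * offdiag b a * diag a c =
      diag b c * diag b c * diag a b + offdiag b c * offdiag c b * diag a c"
  proof -
    \<comment> \<open>With x, y, z the values of \<open>diag\<close> at (a,b), (b,c), (a,c), the
      hypothesis reduces each side to xyz + z.\<close>
    have *: "x * x * y + ((q - p) * x + 1 - x * x) * z = y * y * x + ((q - p) * y + 1 - y * y) * z"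
      if "x * y + z * (q - p - x) = y * z" for x y z :: 'k
    proof -
      have "x * x * y + ((q - p) * x + 1 - x * x) * z = x * (x * y + z * (q - p - x)) + z"
        by (simp add: algebra_simps)
      also have "\<dots> = y * (x * y + z * (q - p - y)) + z"
      proof -
        have "x * y + z * (q - p - y) = x * z"
          using that by (simp add: algebra_simps)
        with that show ?thesis by (simp add: algebra_simps)
      qed
      also have "\<dots> = y * y * x + ((q - p) * y + 1 - y * y) * z"
        by (simp add: algebra_simps)
      finally show ?thesis .
    qed
    have "diag b a = q - p - diag a b"
      using quadratic_coeffs(2)[OF assms(1)] by (simp add: p_def algebra_simps)
    from * [OF id2[unfolded this]] show ?thesis
      unfolding O .
  qed
qed

section \<open>Verification of the defining relations\<close>

lemma basis_expansion:
  assumes "y \<in> free_space std"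
  shows "y = (\<Sum>X\<in>std. scale (Poly_Mapping.lookup y X) (e X))"
proof (rule poly_mapping_eqI)
  fix Y
  have "(\<Sum>X\<in>std. Poly_Mapping.lookup y X * Poly_Mapping.lookup (e X) Y) =
      (\<Sum>X\<in>std. if X = Y then Poly_Mapping.lookup y Y else 0)"
    by (rule sum.cong) (auto simp: basis_vec_def lookup_single when_def)
  then show "Poly_Mapping.lookup y Y =
      Poly_Mapping.lookup (\<Sum>X\<in>std. scale (Poly_Mapping.lookup y X) (e X)) Y"
    using assms finite_std by (auto simp: lookup_sum free_space_def in_keys_iff)
qed

lemma evaluate_zeroI:
  assumes "\<And>X. X \<in> std \<Longrightarrow> evaluate act a (e X) = 0" and y: "y \<in> free_space std"
  shows "evaluate act a y = 0"
  by (subst basis_expansion[OF y])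
    (simp add: linear_op_sum[OF linear_evaluate] linear_opD[OF linear_evaluate] assms(1))

lemmas act_linear = linear_opD[OF linear]

lemma quadratic_relation:
  assumes X: "X \<in> std" and i: "1 \<le> i" "i < n"
  shows "act (Sigma i) (act (Sigma i) (e X)) = scale (q - inverse q) (act (Sigma i) (e X)) + e X"
proof -
  define a b where "a = cont X i" and "b = cont X (i+1)"
  have ne: "a \<noteq> b" using cont_distinct[OF X i] by (simp add: a_def b_def)
  define D D' P P' where "D = diag a b" "D' = diag b a" "P = offdiag a b" "P' = offdiag b a"
  note defs = this
  have s: "act (Sigma i) (e X) = scale D (e X) + scale P (e (swap i X))"
    using sigma_basis[of i X] X by (simp add: a_def b_def defs)
  \<comment> \<open>Only this multiple is available in general: \<open>swap i X\<close> may be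
    nonstandard and its vector zero.\<close>
  have s': "scale P (act (Sigma i) (e (swap i X))) = scale (P * D') (e (swap i X)) + scale (P * P') (e X)"
    using sigma_swap_scaled[OF X i] by (simp add: a_def b_def defs)
  have 1: "D * D + P * P' = (q - inverse q) * D + 1" and "D' = q - inverse q - D"
    using quadratic_coeffs[OF ne] by (simp_all add: defs algebra_simps)
  have "act (Sigma i) (act (Sigma i) (e X)) =
      scale (D * D + P * P') (e X) + scale ((D + D') * P) (e (swap i X))"
    by (simp add: s act_linear s' scale_distribs algebra_simps)
  also have "D + D' = q - inverse q"
    using \<open>D' = q - inverse q - D\<close> by simp
  finally show ?thesis
    unfolding 1 s by (simp only: scale_distribs scale_simps) (simp add: add_ac)
qed

text \<open>Six fillings form a hexagon from \<open>X\<close> to \<open>W\<close>, with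
  \<open>Y\<close>, \<open>Z\<close> on one side and \<open>Y'\<close>, \<open>Z'\<close> on the
  other. In the expansions of both sides the coefficients at \<open>Z\<close>, \<open>Z'\<close>,
  \<open>W\<close> agree at once; the others need \<open>braid_coeffs\<close> or a degenerate
  case.\<close>

lemma braid_relation:
  assumes X: "X \<in> std" and i: "1 \<le> i" "i + 1 < n"
  shows "act (Sigma i) (act (Sigma (i+1)) (act (Sigma i) (e X))) =
    act (Sigma (i+1)) (act (Sigma i) (act (Sigma (i+1)) (e X)))"
proof -
  define j where "j = i + 1"
  have ij: "i < n" "1 \<le> j" "j < n" using i by (auto simp: j_def)
  define a b c where "a = cont X i" and "b = cont X (i+1)" and "c = cont X (i+2)"
  note abc = this
  define Y Y' where "Y = swap i X" and "Y' = swap j X"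
  define Z Z' where "Z = swap j Y" and "Z' = swap i Y'"
  define W where "W = swap i Z"
  note XYZ = Y_def Y'_def Z_def Z'_def W_def
  have W: "W = swap j Z'"
    using swap_braid[OF std_fillings[OF X] i] by (simp add: XYZ j_def)
  have fill: "X \<in> fillings" "Y \<in> fillings" "Y' \<in> fillings" "Z \<in> fillings" "Z' \<in> fillings"
    "W \<in> fillings"
    using X i ij by (auto simp: XYZ std_fillings swap_fillings)
  have XX: "X (pos X k) = k" if "1 \<le> k" "k \<le> n" for k
    using at_pos[OF fill(1) that] .
  have Y_pos: "pos Y k = pos X (transpose i (Suc i) k)" if "1 \<le> k" "k \<le> n" for k
    using pos_swap[OF fill(1)] i ij that by (simp add: Y_def)
  have Y'_pos: "pos Y' k = pos X (transpose j (Suc j) k)" if "1 \<le> k" "k \<le> n" for k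
    using pos_swap[OF fill(1)] i ij that by (simp add: Y'_def)
  have Z_pos: "pos Z k = pos Y (transpose j (Suc j) k)" if "1 \<le> k" "k \<le> n" for k
    using pos_swap[OF fill(2)] i ij that by (simp add: Z_def)
  have Z'_pos: "pos Z' k = pos Y' (transpose i (Suc i) k)" if "1 \<le> k" "k \<le> n" for k
    using pos_swap[OF fill(3)] i ij that by (simp add: Z'_def)
  have pY: "pos Y i = pos X (i+1)" "pos Y (i+1) = pos X i" "pos Y (i+2) = pos X (i+2)"
    using i by (auto simp: Y_pos transpose_def)
  have pY': "pos Y' i = pos X i" "pos Y' (i+1) = pos X (i+2)" "pos Y' (i+2) = pos X (i+1)"
    using i by (auto simp: Y'_pos transpose_def j_def)
  have pZ: "pos Z i = pos X (i+1)" "pos Z (i+1) = pos X (i+2)" "pos Z (i+2) = pos X i"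
    using i pY by (auto simp: Z_pos transpose_def j_def)
  have pZ': "pos Z' i = pos X (i+2)" "pos Z' (i+1) = pos X i" "pos Z' (i+2) = pos X (i+1)"
    using i pY' by (auto simp: Z'_pos transpose_def j_def)
  have pW: "pos W i = pos X (i+2)" "pos W (i+1) = pos X (i+1)" "pos W (i+2) = pos X i"
    using i pos_swap[OF fill(4) i(1) ij(1)] pZ by (auto simp: W_def transpose_def)
  have jj: "j + 1 = i + 2" "Suc j = i + 2" by (simp_all add: j_def)
  \<comment> \<open>Each step away from \<open>X\<close> creates an inversion, so standardness
    passes back along the hexagon; this supplies the hypothesis of
    \<open>sigma_basis\<close>.\<close>
  have ZY: "Y \<in> std" if "Z \<in> std"
    using swap_std_of_inverted[OF X that ij(2,3)] pZ XX[of i] XX[of "i+2"] i swap_swap[OF fill(2) ij(2,3)]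
    by (simp add: Z_def jj) (simp add: j_def)
  have ZY': "Y' \<in> std" if "Z' \<in> std"
    using swap_std_of_inverted[OF X that i(1) ij(1)] pZ' XX[of i] XX[of "i+2"] i swap_swap[OF fill(3) i(1) ij(1)]
    by (simp add: Z'_def)
  have WZ: "Z \<in> std" if "W \<in> std"
    using swap_std_of_inverted[OF X that i(1) ij(1)] pW XX[of "i+1"] XX[of "i+2"] i swap_swap[OF fill(4) i(1) ij(1)]
    by (simp add: W_def)
  have WZ': "Z' \<in> std" if "W \<in> std"
    using swap_std_of_inverted[OF X that ij(2,3)] pW XX[of i] XX[of "i+1"] i swap_swap[OF fill(5) ij(2,3)]
    by (simp add: W jj) (simp add: j_def)
  have nab: "a \<noteq> b" and nbc: "b \<noteq> c"
    using cont_distinct[OF X i(1) ij(1)] cont_distinct[OF X ij(2,3)] by (simp_all add: abc j_def)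
  have cY: "cont Y (i+1) = a" "cont Y (i+2) = c" and cY': "cont Y' i = a" "cont Y' (i+1) = c"
    and cZ: "cont Z i = b" "cont Z (i+1) = c" and cZ': "cont Z' (i+1) = a" "cont Z' (i+2) = b"
    by (simp_all only: abc tab_content_def pY pY' pZ pZ')
  \<comment> \<open>In \<open>Y\<close> and in \<open>Y'\<close> the contents a and c belong to
    consecutive entries.\<close>
  have nac: "a \<noteq> c" if "Y \<in> std \<or> Y' \<in> std"
    using that cont_distinct[of Y j] cont_distinct[of Y' i] i ij cY cY' by (auto simp: j_def)
  define D1 D2 D3 D1' D2' where "D1 = diag a b" "D2 = diag b c" "D3 = diag a c" "D1' = diag b a" "D2' = diag c b"
  define P1 P2 P3 P1' P2' where "P1 = offdiag a b" "P2 = offdiag b c" "P3 = offdiag a c"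
    "P1' = offdiag b a" "P2' = offdiag c b"
  note D = \<open>D1 = diag a b\<close> \<open>D2 = diag b c\<close> \<open>D3 = diag a c\<close> \<open>D1' = diag b a\<close> \<open>D2' = diag c b\<close>
    \<open>P1 = offdiag a b\<close> \<open>P2 = offdiag b c\<close> \<open>P3 = offdiag a c\<close> \<open>P1' = offdiag b a\<close> \<open>P2' = offdiag c b\<close>
  let ?s = "act (Sigma i)" and ?t = "act (Sigma j)"
  have sX: "?s (e X) = scale D1 (e X) + scale P1 (e Y)"
    using sigma_basis[of i X] X by (simp add: D abc Y_def)
  have tX: "?t (e X) = scale D2 (e X) + scale P2 (e Y')"
    using sigma_basis[of j X] X by (simp add: D abc Y'_def j_def)
  have sY: "scale P1 (?s (e Y)) = scale (P1 * D1') (e Y) + scale (P1 * P1') (e X)"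
    using sigma_swap_scaled[OF X i(1) ij(1)] by (simp add: D abc Y_def)
  have tY': "scale P2 (?t (e Y')) = scale (P2 * D2') (e Y') + scale (P2 * P2') (e X)"
    using sigma_swap_scaled[OF X ij(2,3)] by (simp add: D abc Y'_def j_def)
  have tY: "?t (e Y) = scale D3 (e Y) + scale P3 (e Z)"
    using sigma_basis[of j Y] ZY cY by (simp add: D Z_def j_def)
  have sY': "?s (e Y') = scale D3 (e Y') + scale P3 (e Z')"
    using sigma_basis[of i Y'] ZY' cY' by (simp add: D Z'_def)
  have sZ: "?s (e Z) = scale D2 (e Z) + scale P2 (e W)"
    using sigma_basis[of i Z] WZ cZ by (simp add: D W_def)
  have tZ': "?t (e Z') = scale D1 (e Z') + scale P1 (e W)"
    using sigma_basis[of j Z'] WZ' cZ' by (simp add: D W j_def)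
  have sY_scaled: "scale (k * P1) (?s (e Y)) = scale (k * P1 * D1') (e Y) + scale (k * P1 * P1') (e X)" for k
    using arg_cong[OF sY, of "scale k"] by (simp add: scale_distribs mult.assoc)
  have tY'_scaled: "scale (k * P2) (?t (e Y')) = scale (k * P2 * D2') (e Y') + scale (k * P2 * P2') (e X)" for k
    using arg_cong[OF tY', of "scale k"] by (simp add: scale_distribs mult.assoc)
  have lhs: "?s (?t (?s (e X))) =
      scale (D1 * D1 * D2 + P1 * P1' * D3) (e X) + scale (P1 * (D1 * D2 + D3 * D1')) (e Y)
      + scale (D1 * P2 * D3) (e Y') + scale (P1 * P3 * D2) (e Z) + scale (D1 * P2 * P3) (e Z')
      + scale (P1 * P2 * P3) (e W)"
    using sY_scaled[of D3]
    by (simp add: sX tX tY act_linear sY' sZ scale_distribs algebra_simps)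
  have rhs: "?t (?s (?t (e X))) =
      scale (D2 * D2 * D1 + P2 * P2' * D3) (e X) + scale (P1 * (D2 * D3)) (e Y)
      + scale (P2 * (D2 * D1 + D3 * D2')) (e Y') + scale (P1 * P3 * D2) (e Z) + scale (D1 * P2 * P3) (e Z')
      + scale (P1 * P2 * P3) (e W)"
    using tY'_scaled[of D3]
    by (simp add: sX tX sY' act_linear tY tZ' scale_distribs algebra_simps)
  \<comment> \<open>If a = c, neither \<open>Y\<close> nor \<open>Y'\<close> is standard: both
    products of off-diagonal coefficients vanish and \<open>diag_chain\<close> gives
    \<open>D1 = D2\<close>.\<close>
  have X_coeff: "D1 * D1 * D2 + P1 * P1' * D3 = D2 * D2 * D1 + P2 * P2' * D3"
  proof (cases "a = c")
    case False
    then show ?thesis using braid_coeffs(1)[OF nab nbc] by (simp add: D)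
  next
    case True
    then have non: "swap i X \<notin> std" "swap (i+1) X \<notin> std"
      using nac by (auto simp: Y_def Y'_def j_def)
    have "P1 * P1' = 0" "P2 * P2' = 0" "D1 = D2"
      using offdiag_product_zero[OF X i(1) ij(1) non(1)] offdiag_product_zero[OF X ij(2,3)] non(2)
        diag_chain[OF X i non] by (simp_all add: D abc j_def)
    then show ?thesis by (simp del: mult_eq_0_iff)
  qed
  have Y_coeff: "scale (P1 * (D1 * D2 + D3 * D1')) (e Y) = scale (P1 * (D2 * D3)) (e Y)"
    using braid_coeffs(2)[OF nab nbc] nac by (cases "Y \<in> std") (simp_all add: D basis_nonstd)
  have Y'_coeff: "scale (D1 * P2 * D3) (e Y') = scale (P2 * (D2 * D1 + D3 * D2')) (e Y')"
  proof (cases "Y' \<in> std")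
    case True
    then have "D1 * D3 = D2 * D1 + D3 * D2'"
      using braid_coeffs(3)[OF nab nbc] nac by (simp add: D)
    then show ?thesis by (metis mult.assoc mult.commute)
  qed (simp add: basis_nonstd)
  show ?thesis
    using lhs rhs X_coeff Y_coeff Y'_coeff by (simp add: j_def)
qed

text \<open>An exchange of distant entries leaves the contents of \<open>i\<close> and
  \<open>i + 1\<close> alone, so the coefficients do not depend on the order of the two
  operators.\<close>

lemma distant_relation:
  assumes X: "X \<in> std" and i: "1 \<le> i" "i < n" and j: "1 \<le> j" "j < n"
    and dist: "1 < \<bar>int i - int j\<bar>"
  shows "act (Sigma i) (act (Sigma j) (e X)) = act (Sigma j) (act (Sigma i) (e X))"
proof -
  have far: "i + 1 < j \<or> j + 1 < i" using dist by linarith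
  have fill: "X \<in> fillings" using X by (rule std_fillings)
  have step: "act (Sigma k) (e (swap l X)) =
      scale (diag (cont X k) (cont X (k+1))) (e (swap l X))
      + scale (offdiag (cont X k) (cont X (k+1))) (e (swap k (swap l X)))"
    if k: "1 \<le> k" "k < n" and l: "1 \<le> l" "l < n" and kl: "k + 1 < l \<or> l + 1 < k" for k l
  proof -
    let ?Y = "swap l X" and ?W = "swap k (swap l X)"
    have Yf: "?Y \<in> fillings" and Wf: "?W \<in> fillings"
      using fill k l by (simp_all add: swap_fillings)
    have c: "cont ?Y k = cont X k" "cont ?Y (k+1) = cont X (k+1)"
      using cont_swap[OF fill l, of k] cont_swap[OF fill l, of "k+1"] k kl by (auto simp: transpose_def)
    have p: "pos ?W k = pos X (k+1)" "pos ?W (k+1) = pos X k"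
      using pos_swap[OF Yf k, of k] pos_swap[OF Yf k, of "k+1"]
        pos_swap[OF fill l, of k] pos_swap[OF fill l, of "k+1"] k kl by (auto simp: transpose_def)
    have "?Y \<in> std" if "?W \<in> std"
      using swap_std_of_inverted[OF X that k] p at_pos[OF fill, of k] at_pos[OF fill, of "k+1"] k
        swap_swap[OF Yf k] by simp
    then show ?thesis
      using sigma_basis[of k ?Y] c by simp
  qed
  show ?thesis
    using sigma_basis[of i X] sigma_basis[of j X] step[OF i j far] step[OF j i] far X
      swap_commute[OF fill i j far]
    by (simp add: act_linear scale_distribs algebra_simps disj_commute)
qed

text \<open>The operator \<sigma>_1 \<tau> \<sigma>_1 is diagonal in the tableau basis, since its
  coefficient at the exchanged tableau contains the factor aD + bD' = 0; hence it commutes with the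
  diagonal operator \<tau>.\<close>

lemma tau_sigma_relation:
  assumes X: "X \<in> std" and n: "1 < n"
  shows "act Tau (act (Sigma 1) (act Tau (act (Sigma 1) (e X)))) =
    act (Sigma 1) (act Tau (act (Sigma 1) (act Tau (e X))))"
proof -
  have fill: "X \<in> fillings" using X by (rule std_fillings)
  define a b where "a = cont X 1" and "b = cont X 2"
  have ne: "a \<noteq> b" using cont_distinct[OF X, of 1] n by (simp add: a_def b_def numeral_2_eq_2)
  define D D' P P' where "D = diag a b" "D' = diag b a" "P = offdiag a b" "P' = offdiag b a"
  note defs = this
  let ?Y = "swap 1 X"
  have s: "act (Sigma 1) (e X) = scale D (e X) + scale P (e ?Y)"
    using sigma_basis[of 1 X] X by (simp add: a_def b_def defs numeral_2_eq_2)
  have s': "scale P (act (Sigma 1) (e ?Y)) = scale (P * D') (e ?Y) + scale (P * P') (e X)"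
    using sigma_swap_scaled[OF X _ n] by (simp add: a_def b_def defs numeral_2_eq_2)
  have s'_scaled: "scale (k * P) (act (Sigma 1) (e ?Y)) = scale (k * P * D') (e ?Y) + scale (k * P * P') (e X)" for k
    using arg_cong[OF s', of "scale k"] by (simp add: scale_distribs mult.assoc)
  have t: "act Tau (e X) = scale a (e X)"
    by (simp add: tau_basis a_def)
  have t': "act Tau (e ?Y) = scale b (e ?Y)"
    using cont_swap[OF fill _ n, of 1] n by (simp add: tau_basis b_def numeral_2_eq_2)
  have "a * D + b * D' = 0"
    using quadratic_coeffs(3)[OF ne] by (simp add: defs)
  then have D': "b * D' = - (a * D)" by (simp add: eq_neg_iff_add_eq_0 add.commute)
  have sts: "act (Sigma 1) (act Tau (act (Sigma 1) (e X))) = scale (a * D * D + b * P * P') (e X)"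
  proof -
    have "act (Sigma 1) (act Tau (act (Sigma 1) (e X))) =
        scale (a * D * D + b * P * P') (e X) + scale (P * (a * D + b * D')) (e ?Y)"
      using s'_scaled[of b]
      by (simp add: s t t' act_linear scale_distribs algebra_simps del: One_nat_def)
    then show ?thesis by (simp add: D')
  qed
  show ?thesis
    unfolding sts unfolding t
    by (simp add: act_linear sts t scale_distribs mult.commute del: One_nat_def)
qed

lemma tau_commute_relation:
  assumes X: "X \<in> std" and i: "1 < i" "i < n"
  shows "act Tau (act (Sigma i) (e X)) = act (Sigma i) (act Tau (e X))"
proof -
  have "cont (swap i X) 1 = cont X 1"
    using cont_swap[OF std_fillings[OF X], of i 1] i by (simp add: transpose_def)
  then show ?thesis
    using sigma_basis[of i X] X by (simp add: tau_basis act_linear scale_distribs mult.commute)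
qed

lemma scale_diff_left: "scale (c - d) x = scale c x - scale d x"
  by (rule poly_mapping_eqI) (simp add: lookup_minus algebra_simps)

text \<open>The entry 1 occupies the corner of some diagram k, where the content is
  \<open>v k\<close>; one factor of the product therefore vanishes.\<close>

lemma cyclotomic_relation:
  assumes X: "X \<in> std"
  shows "evaluate act (prod_list (map (\<lambda>j. t_gen - scalar (v j)) (sorted_list_of_set UNIV))) (e X) = 0"
proof -
  have "evaluate act (prod_list (map (\<lambda>j. t_gen - scalar (v j)) L)) (e X) =
      scale (\<Prod>j\<leftarrow>L. cont X 1 - v j) (e X)" for L
    by (induction L)
      (simp_all add: linear_opD[OF linear_evaluate] act_linear tau_basis scale_distribs scale_diff_left
        left_diff_distrib mult.commute)
  moreover obtain k where "pos X 1 = (k, 1, 1)"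
    using pos_one[OF X n_pos] .
  then have "cont X 1 = v k"
    by (simp add: tab_content_def node_content_def)
  then have "(\<Prod>j\<leftarrow>sorted_list_of_set UNIV. cont X 1 - v j) = 0"
    by (auto simp: prod_list_zero_iff)
  ultimately show ?thesis by simp
qed

sublocale hecke_action act std n q v
proof
  fix a and y :: "('m node \<Rightarrow> nat) \<Rightarrow>\<^sub>0 'k" assume a: "a \<in> hecke_rels n q v" and y: "y \<in> free_space std"
  have "evaluate act a (e X) = 0" if X: "X \<in> std" for X
    using a X braid_relation[OF X] distant_relation[OF X] tau_sigma_relation[OF X]
      tau_commute_relation[OF X] quadratic_relation[OF X] cyclotomic_relation[OF X]
    unfolding hecke_rels_def
    by (auto split: if_splits)
  then show "evaluate act a y = 0"
    using y by (rule evaluate_zeroI)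
qed

theorem representation: "formulas_define_representation n q v lam"
  unfolding formulas_define_representation_def
proof (intro conjI bexI[of _ rep] ballI)
  show "rep (hecke_class n q v (s_gen i)) (e X) = sigma_formula n q v lam i X"
    if "i \<in> {1..<n}" "X \<in> std" for i X
    using rep_gen[of "Sigma i" "e X"] that basis_in_free_space act_basis
    by (simp add: hecke_gens_def)
  show "rep (hecke_class n q v t_gen) (e X) = tau_formula n q v lam X" if "X \<in> std" for X
    using rep_gen[of Tau "e X"] that basis_in_free_space act_basis
    by (simp add: hecke_gens_def)
qed (use denominators rep_algebra_hom in auto)

end

section \<open>Nonvanishing of the denominators\<close>

lemma (in shape) denominators_nonzeroI:
  fixes q :: "'k::field" and v :: "'m \<Rightarrow> 'k"
  assumes q: "q \<noteq> 0" and v: "\<And>k. v k \<noteq> 0"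
    and same: "\<And>d. d \<noteq> 0 \<Longrightarrow> \<bar>d\<bar> < int n \<Longrightarrow> q powi (2 * d) \<noteq> 1"
    and different: "\<And>d j k. j \<noteq> k \<Longrightarrow> \<bar>d\<bar> < int n \<Longrightarrow> q powi (2 * d) * v j \<noteq> v k"
  shows "denominators_nonzero n q v lam"
  unfolding denominators_nonzero_def
proof (intro ballI)
  fix X i assume X: "X \<in> std" and "i \<in> {1..<n}"
  then have i: "1 \<le> i" "i < n" by auto
  obtain k r s k' r' s' where p: "pos X i = (k, r, s)" "pos X (i+1) = (k', r', s')"
    and N: "(k, r, s) \<in> nodes lam" "(k', r', s') \<in> nodes lam"
    using consecutive_pair[OF X i] by metis
  \<comment> \<open>Up to a common nonzero power of q, equality of the two contents says that q^(2d)
    maps \<open>v k\<close> to \<open>v k'\<close>.\<close>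
  define d where "d = (int s - int r) - (int s' - int r')"
  have d: "\<bar>d\<bar> < int n"
    using diagonal_distance[OF std_fillings[OF X] N] by (simp add: d_def)
  show "tab_content q v lam X (i + 1) - tab_content q v lam X i \<noteq> 0"
  proof
    assume "tab_content q v lam X (i + 1) - tab_content q v lam X i = 0"
    then have "v k' * q powi (2 * (int s' - int r')) = v k * q powi (2 * (int s - int r))"
      using p by (simp add: tab_content_def node_content_def)
    also have "q powi (2 * (int s - int r)) = q powi (2 * d) * q powi (2 * (int s' - int r'))"
      using q by (simp add: d_def algebra_simps flip: power_int_add)
    finally have eq: "q powi (2 * d) * v k = v k'"
      using q by simp
    show False
    proof (cases "k = k'")
      case True
      then have "d \<noteq> 0"
        using consecutive_not_on_diagonal[OF X i p(1)] p(2) by (simp add: d_def)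
      then show False
        using same[OF _ d] eq v True by simp
    qed (use different[OF _ d] eq in blast)
  qed
qed

text \<open>If q^(2d) = 1, the geometric sum of |d| powers of q^2 vanishes because q^2 is not 1,
  against the hypothesis on the sums.\<close>

lemma geometric_nonroot:
  fixes q :: "'k::field"
  assumes "q\<^sup>2 \<noteq> 1" and sums: "\<forall>N<n. (\<Sum>k\<le>N. q ^ (2 * k)) \<noteq> 0"
    and d: "d \<noteq> 0" "\<bar>d\<bar> < int n"
  shows "q powi (2 * d) \<noteq> 1"
proof
  assume one: "q powi (2 * d) = 1"
  \<comment> \<open>The sum up to \<open>N\<close> has |d| terms, and |d| < n keeps \<open>N\<close>
    in the allowed range.\<close>
  define N where "N = nat \<bar>d\<bar> - 1"
  have N: "N < n" and dN: "d = int (Suc N) \<or> d = - int (Suc N)"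
    using d by (auto simp: N_def)
  have "(q\<^sup>2) ^ Suc N = 1"
    using dN
  proof
    assume "d = int (Suc N)"
    then have "q powi (2 * d) = q powi (int (2 * Suc N))" by simp
    then show ?thesis using one by (simp only: power_int_of_nat power_mult)
  next
    assume "d = - int (Suc N)"
    then have "q powi (2 * d) = q powi (- int (2 * Suc N))" by simp
    then have "inverse ((q\<^sup>2) ^ Suc N) = 1"
      using one by (simp only: power_int_minus power_int_of_nat power_mult)
    then show ?thesis by (simp only: inverse_eq_1_iff)
  qed
  moreover have "(\<Sum>k<Suc N. (q\<^sup>2) ^ k) \<noteq> 0"
    using sums N by (simp add: lessThan_Suc_atMost power_mult del: sum.lessThan_Suc)
  ultimately show False
    using assms(1) geometric_sum[of "q\<^sup>2" "Suc N"] by simp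
qed

section \<open>Monomials in the indeterminates\<close>

lemma indet_power: "indet x ^ a = Fract (Poly_Mapping.single (Poly_Mapping.single x a) 1) 1"
proof (induction a)
  case 0
  then show ?case by (simp add: One_fract_def)
next
  case (Suc a)
  then show ?case
    by (simp add: indet_def mult_single flip: single_add)
qed

lemma Fract_monomial_eq_iff:
  "Fract (Poly_Mapping.single \<kappa> (1::complex)) 1 = Fract (Poly_Mapping.single \<mu> 1) 1 \<longleftrightarrow>
     \<kappa> = (\<mu> :: 'm::linorder option \<Rightarrow>\<^sub>0 nat)"
proof
  assume "Fract (Poly_Mapping.single \<kappa> (1::complex)) 1 = Fract (Poly_Mapping.single \<mu> 1) 1"
  then have "Poly_Mapping.single \<kappa> (1::complex) = Poly_Mapping.single \<mu> 1"
    by (simp add: eq_fract)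
  then have "Poly_Mapping.keys (Poly_Mapping.single \<kappa> (1::complex)) = Poly_Mapping.keys (Poly_Mapping.single \<mu> (1::complex))"
    by simp
  then show "\<kappa> = \<mu>" by simp
qed simp

lemma q_indet_power_mult_v_eq_v:
  assumes "q_indet ^ a * v_indet j = v_indet k"
  shows "a = 0 \<and> j = k"
proof -
  have "Poly_Mapping.single None a + Poly_Mapping.single (Some j) 1 = Poly_Mapping.single (Some k) (1::nat)"
    using assms
    by (simp add: q_indet_def v_indet_def indet_power)
      (simp add: indet_def mult_single Fract_monomial_eq_iff)
  then have "Poly_Mapping.lookup (Poly_Mapping.single None a + Poly_Mapping.single (Some j) 1) x =
      Poly_Mapping.lookup (Poly_Mapping.single (Some k) (1::nat)) x" for x
    by simp
  \<comment> \<open>The exponent of q gives \<open>a = 0\<close>, that of the variable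
    \<open>Some j\<close> gives \<open>j = k\<close>.\<close>
  from this[of None] this[of "Some j"] show ?thesis
    by (auto simp: lookup_add lookup_single when_def split: if_splits)
qed

lemma v_indet_nonzero: "v_indet k \<noteq> 0"
  by (simp add: v_indet_def indet_def Zero_fract_def eq_fract)
    (metis keys_single keys_zero insert_not_empty zero_neq_one)

lemma q_indet_nonzero: "q_indet \<noteq> 0"
  using q_indet_power_mult_v_eq_v[of 1 k k] by (simp add: q_indet_def indet_def Zero_fract_def eq_fract)
    (metis keys_single keys_zero insert_not_empty zero_neq_one)

text \<open>A negative power of q is moved to the other side, which exchanges the roles of j and
  k.\<close>

lemma q_indet_powi_mult_v_eq_v:
  assumes "q_indet powi d * v_indet j = v_indet k"
  shows "d = 0 \<and> j = k"
proof (cases "0 \<le> d")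
  case True
  then show ?thesis
    using q_indet_power_mult_v_eq_v[of "nat d" j k] assms by (simp add: power_int_def)
next
  case False
  then have "v_indet j = q_indet ^ nat (- d) * v_indet k"
    using assms by (simp add: power_int_def divide_simps mult.commute q_indet_nonzero)
  then show ?thesis
    using q_indet_power_mult_v_eq_v[of "nat (- d)" k j] False by simp
qed

theorem mainTheorem2:
  fixes n :: nat
    and lam :: "'m::{finite,linorder} \<Rightarrow> nat list"
    and q :: complex
    and v :: "'m \<Rightarrow> complex"
  assumes "1 \<le> n"
    and "is_mpartition n lam"
  shows "formulas_define_representation n (q_indet :: 'm ratfun) v_indet lam \<and>
    (admissible n q v \<and> (q\<^sup>2 \<noteq> 1 \<or> denominators_nonzero n q v lam) \<longrightarrow>
       formulas_define_representation n q v lam)"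
proof -
  interpret shape n lam
    using assms(2) by unfold_locales (simp add: is_mpartition_def)
  \<comment> \<open>Stated for an arbitrary field, since it is used both for rational functions and
    for the complex numbers.\<close>
  have rep: "formulas_define_representation n q' v' lam"
    if "q' \<noteq> 0" "denominators_nonzero n q' v' lam" for q' :: "'k::field" and v' :: "'m \<Rightarrow> 'k"
  proof -
    interpret seminormal n lam q' v'
      using that assms(1) by unfold_locales
    show ?thesis by (rule representation)
  qed
  have "denominators_nonzero n (q_indet :: 'm ratfun) v_indet lam"
  proof (rule denominators_nonzeroI)
    show "q_indet powi (2 * d) \<noteq> (1 :: 'm ratfun)" if "d \<noteq> 0" for d
      \<comment> \<open>Any index serves here: multiplying q^(2d) = 1 by one and the same variable
        gives an equation of the required form.\<close>
      using q_indet_powi_mult_v_eq_v[of "2 * d" undefined undefined] that by auto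
    show "q_indet powi (2 * d) * v_indet j \<noteq> v_indet k" if "j \<noteq> k" for d and j k :: 'm
      using q_indet_powi_mult_v_eq_v that by blast
  qed (rule q_indet_nonzero v_indet_nonzero)+
  moreover have "denominators_nonzero n q v lam"
    if adm: "admissible n q v" and "q\<^sup>2 \<noteq> 1 \<or> denominators_nonzero n q v lam"
  \<comment> \<open>For \<open>q\<^sup>2 = 1\<close> the assumed alternative supplies the
    denominators; otherwise the geometric sums rule out that q^2 is a root of unity of small
    order.\<close>
  proof (cases "q\<^sup>2 = 1")
    case False
    have sums: "\<forall>N<n. (\<Sum>k\<le>N. q ^ (2 * k)) \<noteq> 0"
      using adm by (simp add: admissible_def)
    have "q powi (2 * d) * v j \<noteq> v k" if "j \<noteq> k" "\<bar>d\<bar> < int n" for d j k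
    proof -
      have "- int n < d" "d < int n" using that by auto
      then show ?thesis using adm \<open>j \<noteq> k\<close> by (auto simp: admissible_def)
    qed
    then show ?thesis
      using adm by (intro denominators_nonzeroI geometric_nonroot[OF False sums])
        (simp_all add: admissible_def)
  qed (use that in auto)
  ultimately show ?thesis
    using rep[OF q_indet_nonzero] rep[of q v] by (auto simp: admissible_def)
qed

end
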